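(* There exists a universal constant $C>0$ such that the following holds. Let $n\ge 4$ be an integer divisible by four, and let $$\theta=(\theta_1,\ldots,\theta_n)=\frac{1}{\sqrt{3n/2}}\,\bigl(1,\sqrt2,-1,-\sqrt2,1,\sqrt2,-1,-\sqrt2,\ldots\bigr)\in\mathbb{R}^n,$$ where the block $(1,\sqrt2,-1,-\sqrt2)$ is repeated $n/4$ times. Suppose that $X_1,\ldots,X_n$ are independent, identically distributed real random variables of mean zero and variance one with $\mathbb{E}|X_1|^4\le\delta^4$, where $\delta>0$. Then $$\sup_{\alpha,\beta\in\mathbb{R},\ \alpha<\beta}\left|\mathbb{P}\left(\alpha\le\sum_{j=1}^n\theta_jX_j\le\beta\right)-\frac{1}{\sqrt{2\pi}}\int_\alpha^\beta e^{-t^2/2}\,dt\right|\le\frac{C\delta^4}{n}.$$ *)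

theory Defs
  imports "HOL-Probability.Probability"
begin

text \<open>Coordinates are indexed by \<open>j = 1, \<dots>, n\<close>.\<close>

definition theta :: "nat \<Rightarrow> nat \<Rightarrow> real" where
  "theta n j =
     (if j mod 4 = 1 then 1
      else if j mod 4 = 2 then sqrt 2
      else if j mod 4 = 3 then - 1
      else - sqrt 2) / sqrt (3 * real n / 2)"

text \<open>The integrability conditions are needed because the Bochner integral of a non-integrable
  function is 0; integrability of the square follows from that of the fourth power.\<close>

definition iid_standardized :: "'a measure \<Rightarrow> nat \<Rightarrow> (nat \<Rightarrow> 'a \<Rightarrow> real) \<Rightarrow> real \<Rightarrow> bool" where
  "iid_standardized M n X \<delta> \<longleftrightarrow>
     prob_space M \<and>
     prob_space.indep_vars M (\<lambda>_. borel) X {1..n} \<and>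
     (\<forall>j\<in>{1..n}. distr M borel (X j) = distr M borel (X 1)) \<and>
     (\<forall>j\<in>{1..n}. integrable M (X j)
                \<and> prob_space.expectation M (X j) = 0
                \<and> prob_space.variance M (X j) = 1) \<and>
     integrable M (\<lambda>\<omega>. \<bar>X 1 \<omega>\<bar> ^ 4) \<and>
     prob_space.expectation M (\<lambda>\<omega>. \<bar>X 1 \<omega>\<bar> ^ 4) \<le> \<delta> ^ 4"

text \<open>For a probability space the values below lie in \<open>[0, 1]\<close>, so this real-valued supremum
  is a genuine one.\<close>

definition normal_discrepancy :: "'a measure \<Rightarrow> ('a \<Rightarrow> real) \<Rightarrow> real" where
  "normal_discrepancy M S =
     (SUP (\<alpha>, \<beta>)\<in>{(\<alpha>, \<beta>). \<alpha> < \<beta>}.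
        \<bar>\<P>(\<omega> in M. \<alpha> \<le> S \<omega> \<and> S \<omega> \<le> \<beta>)
          - 1 / sqrt (2 * pi) * integral {\<alpha>..\<beta>} (\<lambda>t. exp (- (t ^ 2) / 2))\<bar>)"

definition berry_esseen_on :: "'a measure \<Rightarrow> real \<Rightarrow> bool" where
  "berry_esseen_on M C \<longleftrightarrow>
     (\<forall>n \<delta> X. 4 \<le> n \<and> 4 dvd n \<and> 0 < \<delta> \<and> iid_standardized M n X \<delta> \<longrightarrow>
        normal_discrepancy M (\<lambda>\<omega>. \<Sum>j=1..n. theta n j * X j \<omega>) \<le> C * \<delta> ^ 4 / real n)"

text \<open>
  The constant has to be chosen before the probability space, but HOL cannot quantify over the
  type \<^typ>\<open>'a\<close> of sample points underneath an existential: in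
  \<open>\<exists>C>0. \<forall>M :: 'a measure. berry_esseen_on M C\<close> the constant could depend on \<^typ>\<open>'a\<close>.
  The theorem is therefore a conjunction: some \<open>C > 0\<close> works for all
  probability spaces on the fixed type \<^typ>\<open>nat \<Rightarrow> real\<close>, and every such \<open>C\<close> works for all
  probability spaces on an arbitrary type \<^typ>\<open>'a\<close>. Together these say that one and the same
  \<open>C\<close> works on all sample spaces of all types.
\<close>

end

theory Submission
  imports Defs
begin

text \<open>
  Let \<open>f\<close> be the characteristic function of \<open>X\<^sub>1\<close>, and put \<open>m = n / 4\<close> and \<open>s = \<xi> / sqrt (3 n / 2)\<close>. Each
  block \<open>(1, sqrt 2, -1, -sqrt 2)\<close> contributes \<open>|f s|\<^sup>2 |f (sqrt 2 s)|\<^sup>2\<close> to the characteristic function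
  of the sum, so only the law of \<open>Y = X - X'\<close>, with \<open>X'\<close> an independent copy of \<open>X\<close>, matters, and third
  moments cancel. By Esseen's inequality with cut-off \<open>\<xi> \<le> const * n / \<delta>^4\<close> it is enough to integrate
  the difference of this characteristic function and the Gaussian one against \<open>d\<xi> / \<xi>\<close>.

  For \<open>s \<le> 1 / (2 \<delta>\<^sup>2)\<close> a fourth order Taylor expansion suffices. For larger \<open>s\<close> the \<open>m\<close>-th power of a
  block is at most \<open>exp (- m E (osc (s Y)))\<close> with \<open>osc t = 2 - cos t - cos (sqrt 2 t)\<close>. A pointwise
  bound does not give the rate \<open>1 / n\<close>; instead Jensen's inequality with the weight \<open>Y\<^sup>2\<close>, restricted to
  \<open>|Y| \<le> 4 \<delta>\<^sup>2\<close>, reduces the problem to the integral of \<open>exp (- N osc t) / t\<close> over \<open>\<pi> < t \<le> L\<close>. Near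
  \<open>t = 2 \<pi> p\<close> the exponent is governed by the distance of \<open>sqrt 2 p\<close> to the nearest integer. Since \<open>sqrt 2\<close>
  is badly approximable, these distances are at least \<open>1 / (4 p)\<close> and well separated from each other,
  which bounds the integral by a multiple of \<open>L\<^sup>2 / N\<^sup>2\<close>.
\<close>

section \<open>Approximation of the square root of two\<close>

text \<open>The third order Taylor polynomial of \<open>exp (i x)\<close> has real part
  \<open>1 - x^2 / 2\<close>, its cubic term being imaginary, so the remainder is already of fourth
  order.\<close>

lemma cos_approx4: "\<bar>cos x - (1 - x\<^sup>2 / 2)\<bar> \<le> x ^ 4 / 24" for x :: real
proof -
  have "Re (\<Sum>k\<le>3. (\<i> * complex_of_real x) ^ k / fact k) = 1 - x\<^sup>2 / 2"
    by (simp add: eval_nat_numeral fact_numeral field_simps)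
  then have "\<bar>cos x - (1 - x\<^sup>2 / 2)\<bar> = \<bar>Re (iexp x - (\<Sum>k\<le>3. (\<i> * x) ^ k / fact k))\<bar>"
    by (simp del: sum.atMost_Suc add: cis_conv_exp[symmetric])
  also have "\<dots> \<le> \<bar>x\<bar> ^ Suc 3 / fact (Suc 3)"
    by (rule order_trans[OF abs_Re_le_cmod iexp_approx1])
  finally show ?thesis
    by (simp add: fact_numeral)
qed

text \<open>Up to 3 the Taylor bound suffices; between 3 and \<open>3 * pi / 2\<close> the cosine is
  nonpositive and \<open>v^2\<close> is at most 25. The range extends past \<open>pi\<close> because
  the argument \<open>v\<close> in \<open>osc_near_period\<close> is only bounded by
  \<open>pi + 3 / 4\<close>.\<close>

lemma one_minus_cos_lower:
  fixes v :: real
  assumes "\<bar>v\<bar> \<le> 3 * pi / 2"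
  shows "v\<^sup>2 / 25 \<le> 1 - cos v"
proof (cases "\<bar>v\<bar> \<le> 3")
  case True
  then have "v\<^sup>2 \<le> 9"
    using abs_le_square_iff[of v 3] by simp
  then have "v\<^sup>2 * v\<^sup>2 \<le> 9 * v\<^sup>2"
    by (intro mult_right_mono) auto
  then have "v ^ 4 \<le> 9 * v\<^sup>2"
    by (simp add: power4_eq_xxxx power2_eq_square)
  then show ?thesis
    using cos_approx4[of v] zero_le_power2[of v] unfolding abs_le_iff by linarith
next
  case False
  have "cos \<bar>v\<bar> = - cos (\<bar>v\<bar> - pi)"
    by (simp add: cos_diff)
  moreover have "0 \<le> cos (\<bar>v\<bar> - pi)"
    using False assms pi_less_4 by (intro cos_ge_zero) auto
  ultimately have "cos v \<le> 0"
    by simp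
  moreover have "v\<^sup>2 \<le> 25"
    using abs_le_square_iff[of v 5] assms pi_approx by simp
  ultimately show ?thesis
    by simp
qed

text \<open>Norm argument: \<open>2 k^2 - q^2\<close> is a nonzero integer and factors as
  \<open>(sqrt 2 k - q) (sqrt 2 k + q)\<close>. The second factor is at most \<open>4 k\<close> when
  \<open>q\<close> is within 1/2 of \<open>sqrt 2 k\<close>.\<close>

lemma sqrt2_approx_lower:
  fixes k q :: int
  assumes "k > 0"
  shows "1 / (4 * k) \<le> \<bar>sqrt 2 * k - q\<bar>"
proof (cases "\<bar>sqrt 2 * k - q\<bar> \<le> 1 / 2")
  case True
  have s: "1 < sqrt 2" "sqrt 2 < 3 / 2"
    by (simp, rule real_less_lsqrt) (simp_all add: power2_eq_square)
  have k1: "1 \<le> real_of_int k"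
    using assms by simp
  have sk: "real_of_int k \<le> sqrt 2 * k" "sqrt 2 * k \<le> 3 / 2 * k"
    using s k1 by (auto intro: mult_right_mono)
  have q: "0 < real_of_int q" "sqrt 2 * k + q \<le> 4 * k"
    using True k1 sk unfolding abs_le_iff by linarith+
  \<comment> \<open>Irrationality of the root: the exponent of 2 is odd on the left and even on the
    right.\<close>
  have "2 * k\<^sup>2 \<noteq> q\<^sup>2"
  proof
    assume "2 * k\<^sup>2 = q\<^sup>2"
    then have "multiplicity 2 (2 * k\<^sup>2) = multiplicity 2 (q\<^sup>2)"
      by simp
    moreover have "multiplicity 2 (2 * k\<^sup>2) = 1 + 2 * multiplicity 2 k"
      using assms by (subst prime_elem_multiplicity_mult_distrib)
        (auto simp: prime_elem_multiplicity_power_distrib)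
    moreover have "multiplicity 2 (q\<^sup>2) = 2 * multiplicity 2 q"
      using q by (intro prime_elem_multiplicity_power_distrib) auto
    ultimately show False
      by presburger
  qed
  then have "1 \<le> \<bar>2 * k\<^sup>2 - q\<^sup>2\<bar>"
    by linarith
  then have "1 \<le> real_of_int \<bar>2 * k\<^sup>2 - q\<^sup>2\<bar>"
    by linarith
  also have "real_of_int \<bar>2 * k\<^sup>2 - q\<^sup>2\<bar> = \<bar>(sqrt 2 * k - q) * (sqrt 2 * k + q)\<bar>"
    by (simp add: algebra_simps power2_eq_square)
  also have "\<dots> = \<bar>sqrt 2 * k - q\<bar> * (sqrt 2 * k + q)"
    using sk k1 q by (simp add: abs_mult)
  also have "\<dots> \<le> \<bar>sqrt 2 * k - q\<bar> * (4 * k)"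
    using q by (intro mult_left_mono) auto
  finally show ?thesis
    using k1 by (simp add: field_simps)
next
  case False
  have "1 / (4 * real_of_int k) \<le> 1 / 2"
    using assms by (simp add: field_simps)
  then show ?thesis
    using False by linarith
qed

definition sqrt2_frac :: "nat \<Rightarrow> real" where
  "sqrt2_frac p = sqrt 2 * p - round (sqrt 2 * p)"

lemma sqrt2_frac_le: "\<bar>sqrt2_frac p\<bar> \<le> 1 / 2"
  unfolding sqrt2_frac_def using of_int_round_abs_le[of "sqrt 2 * p"] by (simp add: abs_minus_commute)

lemma sqrt2_frac_ge:
  assumes "0 < p"
  shows "1 / (4 * p) \<le> \<bar>sqrt2_frac p\<bar>"
  using sqrt2_approx_lower[of "int p" "round (sqrt 2 * p)"] assms by (simp add: sqrt2_frac_def)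

text \<open>The difference of two values is \<open>sqrt 2 * (q - p)\<close> up to an integer, so the
  approximation bound applies with denominator \<open>q - p\<close>.\<close>

lemma sqrt2_frac_separated:
  assumes "p < q"
  shows "1 / (4 * real (q - p)) \<le> \<bar>sqrt2_frac q - sqrt2_frac p\<bar>"
proof -
  have "sqrt2_frac q - sqrt2_frac p
      = sqrt 2 * int (q - p) - of_int (round (sqrt 2 * q) - round (sqrt 2 * p))"
    using assms by (simp add: sqrt2_frac_def algebra_simps of_nat_diff)
  then show ?thesis
    using sqrt2_approx_lower[of "int (q - p)" "round (sqrt 2 * q) - round (sqrt 2 * p)"] assms
    by simp
qed

text \<open>Telescoping comparison with \<open>1 / n - 1 / (n + 1)\<close>. Arbitrary finite index
  sets are allowed because the sum is later taken over the occupied cells only.\<close>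

lemma sum_inverse_squares_le:
  assumes "finite A" "0 \<notin> A"
  shows "(\<Sum>k\<in>A. 1 / (real k)\<^sup>2) \<le> 2"
proof -
  have "(\<Sum>k\<in>A. 1 / (real k)\<^sup>2) \<le> (\<Sum>k\<in>{1..Max (insert 1 A)}. 1 / (real k)\<^sup>2)"
    using assms by (intro sum_mono2) (auto simp: Suc_le_eq intro: gr0I)
  also have "(\<Sum>k\<in>{1..n}. 1 / (real k)\<^sup>2) \<le> 2 - 1 / real n" if "1 \<le> n" for n
    using that
  proof (induction n rule: dec_induct)
    case (step n)
    have "1 / (real (Suc n))\<^sup>2 \<le> 1 / (real n * real (Suc n))"
      using step by (intro divide_left_mono) (auto simp: power2_eq_square intro: mult_right_mono)
    also have "\<dots> = 1 / real n - 1 / real (Suc n)"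
      using step by (simp add: field_simps)
    finally show ?case
      using step by simp
  qed simp
  then have "(\<Sum>k\<in>{1..Max (insert 1 A)}. 1 / (real k)\<^sup>2) \<le> 2 - 1 / real (Max (insert 1 A))"
    using assms by simp
  finally show ?thesis
    by (smt (verit) divide_nonneg_nonneg of_nat_0_le_iff)
qed

text \<open>The multiples of \<open>1 / (4 P)\<close> cut the line into cells; cells of one sign contain at most one
  point \<open>sqrt2_frac p\<close>, and the cells next to 0 contain none.\<close>

lemma sum_inverse_sqrt2_frac_squares:
  "(\<Sum>p\<in>{1..P}. 1 / (sqrt2_frac p)\<^sup>2) \<le> 64 * (real P)\<^sup>2"
proof (cases "P = 0")
  case False
  define cell where "cell p = nat \<lfloor>4 * P * \<bar>sqrt2_frac p\<bar>\<rfloor>" for p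
  have ge: "1 \<le> 4 * P * \<bar>sqrt2_frac p\<bar>" if "p \<in> {1..P}" for p
  proof -
    have "1 / (4 * real P) \<le> 1 / (4 * real p)"
      using that by (intro divide_left_mono) auto
    also have "\<dots> \<le> \<bar>sqrt2_frac p\<bar>"
      using that by (intro sqrt2_frac_ge) auto
    finally show ?thesis
      using False by (simp add: field_simps)
  qed
  then have ne: "sqrt2_frac p \<noteq> 0" if "p \<in> {1..P}" for p
    using that by fastforce
  have cell_ge: "1 \<le> cell p" if "p \<in> {1..P}" for p
    using ge[OF that] by (simp add: cell_def nat_le_iff le_nat_iff)
  have cell_le: "real (cell p) \<le> 4 * P * \<bar>sqrt2_frac p\<bar>" for p
    by (simp add: cell_def)
  have term_le: "1 / (sqrt2_frac p)\<^sup>2 \<le> 16 * (real P)\<^sup>2 * (1 / (real (cell p))\<^sup>2)" if "p \<in> {1..P}" for p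
  proof -
    have "(real (cell p))\<^sup>2 \<le> (4 * P * \<bar>sqrt2_frac p\<bar>)\<^sup>2"
      using cell_le[of p] by (intro power_mono) auto
    then have *: "(real (cell p))\<^sup>2 \<le> 16 * (real P)\<^sup>2 * (sqrt2_frac p)\<^sup>2"
      by (simp add: power_mult_distrib)
    have "0 < (real (cell p))\<^sup>2"
      using cell_ge[OF that] by simp
    moreover have "0 < (sqrt2_frac p)\<^sup>2"
      using ge[OF that] by auto
    ultimately show ?thesis
      using * by (simp add: field_simps)
  qed
  \<comment> \<open>The factor \<open>\<sigma>\<close> is 1 or -1 and selects a sign. For equal
    signs the distance of the absolute values is that of the values, and two points in one cell
    would be closer than \<open>1 / (4 * P)\<close>, against
    \<open>sqrt2_frac_separated\<close>.\<close>
  have inj: "inj_on cell {p \<in> {1..P}. 0 < \<sigma> * sqrt2_frac p}" if "\<bar>\<sigma>\<bar> = 1" for \<sigma> :: real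
  proof (rule linorder_inj_onI)
    fix p q assume pq: "p < q" and p: "p \<in> {p \<in> {1..P}. 0 < \<sigma> * sqrt2_frac p}"
      and q: "q \<in> {p \<in> {1..P}. 0 < \<sigma> * sqrt2_frac p}"
    have "\<sigma> = 1 \<or> \<sigma> = -1"
      using that by linarith
    then have sgn: "\<bar>\<bar>sqrt2_frac p\<bar> - \<bar>sqrt2_frac q\<bar>\<bar> = \<bar>sqrt2_frac q - sqrt2_frac p\<bar>"
      using p q by auto
    show "cell p \<noteq> cell q"
    proof
      assume "cell p = cell q"
      then have "\<lfloor>4 * P * \<bar>sqrt2_frac p\<bar>\<rfloor> = \<lfloor>4 * P * \<bar>sqrt2_frac q\<bar>\<rfloor>"
        by (simp add: cell_def nat_eq_iff2)
      then have "\<bar>4 * P * \<bar>sqrt2_frac p\<bar> - 4 * P * \<bar>sqrt2_frac q\<bar>\<bar> < 1"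
        by linarith
      also have "4 * P * \<bar>sqrt2_frac p\<bar> - 4 * P * \<bar>sqrt2_frac q\<bar>
          = 4 * P * (\<bar>sqrt2_frac p\<bar> - \<bar>sqrt2_frac q\<bar>)"
        by (simp add: algebra_simps)
      also have "\<bar>4 * P * (\<bar>sqrt2_frac p\<bar> - \<bar>sqrt2_frac q\<bar>)\<bar> = 4 * P * \<bar>sqrt2_frac q - sqrt2_frac p\<bar>"
        using sgn by (simp add: abs_mult)
      finally have "4 * P * \<bar>sqrt2_frac q - sqrt2_frac p\<bar> < 1" .
      moreover have "1 / (4 * real P) \<le> 1 / (4 * real (q - p))"
        using p q pq by (intro divide_left_mono) auto
      then have "1 / (4 * real P) \<le> \<bar>sqrt2_frac q - sqrt2_frac p\<bar>"
        using sqrt2_frac_separated[OF pq] by (rule order_trans)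
      then have "1 \<le> 4 * P * \<bar>sqrt2_frac q - sqrt2_frac p\<bar>"
        using False by (simp add: field_simps)
      ultimately show False
        by linarith
    qed
  qed auto
  have half: "(\<Sum>p\<in>{p \<in> {1..P}. 0 < \<sigma> * sqrt2_frac p}. 1 / (sqrt2_frac p)\<^sup>2) \<le> 32 * (real P)\<^sup>2"
    if "\<bar>\<sigma>\<bar> = 1" for \<sigma> :: real
  proof -
    let ?S = "{p \<in> {1..P}. 0 < \<sigma> * sqrt2_frac p}"
    have "(\<Sum>p\<in>?S. 1 / (sqrt2_frac p)\<^sup>2) \<le> (\<Sum>p\<in>?S. 16 * (real P)\<^sup>2 * (1 / (real (cell p))\<^sup>2))"
      by (intro sum_mono term_le) auto
    also have "\<dots> = 16 * (real P)\<^sup>2 * (\<Sum>k\<in>cell ` ?S. 1 / (real k)\<^sup>2)"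
      by (subst sum.reindex[OF inj[OF that]]) (simp add: sum_distrib_left)
    also have "\<dots> \<le> 16 * (real P)\<^sup>2 * 2"
      using cell_ge by (intro mult_left_mono sum_inverse_squares_le) (auto, fastforce)
    finally show ?thesis by simp
  qed
  have "{1..P} = {p \<in> {1..P}. 0 < 1 * sqrt2_frac p} \<union> {p \<in> {1..P}. 0 < -1 * sqrt2_frac p}"
    by (intro equalityI subsetI) (use ne in \<open>force simp: neq_iff\<close>)+
  then have "(\<Sum>p\<in>{1..P}. 1 / (sqrt2_frac p)\<^sup>2)
      = (\<Sum>p\<in>{p \<in> {1..P}. 0 < 1 * sqrt2_frac p} \<union> {p \<in> {1..P}. 0 < -1 * sqrt2_frac p}. 1 / (sqrt2_frac p)\<^sup>2)"
    by (rule arg_cong)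
  also have "\<dots> = (\<Sum>p\<in>{p \<in> {1..P}. 0 < 1 * sqrt2_frac p}. 1 / (sqrt2_frac p)\<^sup>2)
      + (\<Sum>p\<in>{p \<in> {1..P}. 0 < -1 * sqrt2_frac p}. 1 / (sqrt2_frac p)\<^sup>2)"
    by (intro sum.union_disjoint) auto
  also have "\<dots> \<le> 32 * (real P)\<^sup>2 + 32 * (real P)\<^sup>2"
    by (intro add_mono half) auto
  finally show ?thesis by simp
qed simp

section \<open>The oscillating exponent\<close>

definition osc :: "real \<Rightarrow> real" where
  "osc t = (1 - cos t) + (1 - cos (sqrt 2 * t))"

lemma osc_nonneg: "0 \<le> osc t"
  using cos_le_one[of t] cos_le_one[of "sqrt 2 * t"] unfolding osc_def by linarith

lemma osc_le: "osc t \<le> 4"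
  using cos_ge_minus_one[of t] cos_ge_minus_one[of "sqrt 2 * t"] unfolding osc_def by linarith

lemma osc_measurable [measurable]: "osc \<in> borel_measurable borel"
  unfolding osc_def by measurable

lemma osc_minus [simp]: "osc (- t) = osc t"
  by (simp add: osc_def)

lemma osc_ge_square: "\<bar>t\<bar> \<le> pi \<Longrightarrow> t\<^sup>2 / 25 \<le> osc t"
  using one_minus_cos_lower[of t] cos_le_one[of "sqrt 2 * t"] pi_gt_zero unfolding osc_def by linarith

text \<open>The larger of \<open>u\<close> and \<open>e = sqrt2_frac p\<close> decides which cosine
  is used. If \<open>u\<close> dominates, the first one gives \<open>u^2 / 25\<close>. Otherwise the
  second has argument \<open>v = 2 * pi * e + sqrt 2 * u\<close> modulo \<open>2 * pi\<close>, and
  \<open>v\<close> is comparable to \<open>e\<close>.\<close>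

lemma osc_near_period:
  assumes "\<bar>u\<bar> \<le> pi"
  shows "(u\<^sup>2 + (sqrt2_frac p)\<^sup>2) / 50 \<le> osc (2 * pi * p + u)"
proof (cases "\<bar>sqrt2_frac p\<bar> \<le> \<bar>u\<bar>")
  case True
  then have "(sqrt2_frac p)\<^sup>2 \<le> u\<^sup>2"
    by (simp add: abs_le_square_iff)
  moreover have "cos (2 * pi * p + u) = cos u"
    using sin_integer_2pi[of "real p"] cos_integer_2pi[of "real p"] by (simp add: cos_add)
  moreover have "u\<^sup>2 / 25 \<le> 1 - cos u"
    using assms pi_gt_zero by (intro one_minus_cos_lower) linarith
  moreover have "0 \<le> 1 - cos (sqrt 2 * (2 * pi * p + u))"
    by simp
  ultimately have "u\<^sup>2 / 25 + 0 \<le> osc (2 * pi * p + u)"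
    unfolding osc_def by (intro add_mono) simp_all
  then show ?thesis
    using \<open>(sqrt2_frac p)\<^sup>2 \<le> u\<^sup>2\<close> by simp
next
  case False
  define e where "e = sqrt2_frac p"
  define v where "v = 2 * pi * e + sqrt 2 * u"
  have s2: "sqrt 2 < 3 / 2"
    by (rule real_less_lsqrt) (simp_all add: power2_eq_square)
  have "sqrt 2 * (2 * pi * p + u) = v + 2 * pi * round (sqrt 2 * p)"
    by (simp add: v_def e_def sqrt2_frac_def algebra_simps)
  then have cos_v: "cos (sqrt 2 * (2 * pi * p + u)) = cos v"
    by (simp add: cos_add)
  have ue: "\<bar>sqrt 2 * u\<bar> \<le> 3 / 2 * \<bar>e\<bar>"
    using False s2 unfolding abs_mult e_def by (intro mult_mono) auto
  have pe: "\<bar>2 * pi * e\<bar> = 2 * pi * \<bar>e\<bar>"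
    by (simp add: abs_mult)
  have e: "\<bar>e\<bar> \<le> 1 / 2"
    unfolding e_def by (rule sqrt2_frac_le)
  have pi3: "3 * \<bar>e\<bar> \<le> pi * \<bar>e\<bar>"
    using pi_gt3 by (intro mult_right_mono) auto
  have "\<bar>v\<bar> \<le> 2 * pi * \<bar>e\<bar> + 3 / 2 * \<bar>e\<bar>"
    using ue pe unfolding v_def by linarith
  also have "\<dots> \<le> 2 * pi * (1 / 2) + 3 / 2 * (1 / 2)"
    using e by (intro add_mono mult_left_mono) auto
  also have "\<dots> \<le> 3 * pi / 2"
    using pi_gt3 by simp
  finally have "v\<^sup>2 / 25 \<le> 1 - cos v"
    by (rule one_minus_cos_lower)
  \<comment> \<open>Since \<open>2 * pi - 3 / 2\<close> exceeds 4, the shift by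
    \<open>sqrt 2 * u\<close> cannot cancel the main term \<open>2 * pi * e\<close>.\<close>
  moreover have "\<bar>4 * e\<bar> \<le> \<bar>v\<bar>"
    using ue pe pi3 unfolding v_def by linarith
  then have "16 * e\<^sup>2 \<le> v\<^sup>2"
    unfolding abs_le_square_iff by (simp add: power_mult_distrib)
  moreover have "u\<^sup>2 \<le> e\<^sup>2"
    using False unfolding e_def by (simp flip: abs_le_square_iff)
  moreover have "0 + (1 - cos v) \<le> osc (2 * pi * p + u)"
    unfolding osc_def cos_v by (intro add_mono) simp_all
  ultimately have "v\<^sup>2 / 25 \<le> osc (2 * pi * p + u)"
    by simp
  moreover have "(u\<^sup>2 + e\<^sup>2) / 50 \<le> v\<^sup>2 / 25"
    using \<open>16 * e\<^sup>2 \<le> v\<^sup>2\<close> \<open>u\<^sup>2 \<le> e\<^sup>2\<close> zero_le_power2[of e] by argo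
  ultimately show ?thesis
    unfolding e_def by (rule order_trans[rotated])
qed

lemma exp_minus_le_inverse_square:
  fixes x :: real
  assumes "0 < x"
  shows "exp (- x) \<le> 2 / x\<^sup>2"
proof -
  have "x\<^sup>2 / 2 \<le> exp x"
    using exp_lower_Taylor_quadratic[of x] assms by simp
  then show ?thesis
    using assms by (simp add: exp_minus field_simps)
qed

text \<open>With \<open>r = (t - 2 * pi * p)^2 + e^2\<close> the exponential is at most
  \<open>5000 / (N * r)^2\<close>. One factor \<open>r\<close> is bounded below by
  \<open>e^2\<close>; the other is integrated to an arctangent and contributes at most
  \<open>4 / e\<close>.\<close>

lemma nn_integral_osc_period:
  assumes "0 < p" "0 < N"
  shows "(\<integral>\<^sup>+t\<in>{2 * pi * p - pi..2 * pi * p + pi}. ennreal (exp (- N * osc t) / t) \<partial>lborel)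
    \<le> ennreal (27000 / N\<^sup>2 * (1 / (sqrt2_frac p)\<^sup>2))"
proof -
  define e where "e = \<bar>sqrt2_frac p\<bar>"
  have e4: "1 / (4 * p) \<le> e"
    unfolding e_def using sqrt2_frac_ge[OF assms(1)] by simp
  then have e0: "0 < e"
    by (rule less_le_trans[rotated]) (use assms in simp)
  let ?c = "2 * pi * real p"
  let ?F = "\<lambda>t. arctan ((t - ?c) / e) / e"
  let ?K = "6700 / (N\<^sup>2 * e)"
  have bound: "exp (- N * osc t) / t \<le> ?K * (1 / ((t - ?c)\<^sup>2 + e\<^sup>2))" if "t \<in> {?c - pi..?c + pi}" for t
  proof -
    define r where "r = (t - ?c)\<^sup>2 + e\<^sup>2"
    have r: "e\<^sup>2 \<le> r" "0 < r"
      using e0 by (auto simp: r_def intro: add_nonneg_pos)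
    have "r / 50 \<le> osc t"
      using osc_near_period[of "t - ?c" p] that by (auto simp: r_def e_def)
    then have "exp (- N * osc t) \<le> exp (- (N * (r / 50)))"
      using assms by simp
    also have "\<dots> \<le> 2 / (N * (r / 50))\<^sup>2"
      using assms r by (intro exp_minus_le_inverse_square) auto
    also have "\<dots> = 5000 / (N\<^sup>2 * r\<^sup>2)"
      by (simp add: power_mult_distrib power_divide)
    also have "\<dots> \<le> 5000 / (N\<^sup>2 * (e\<^sup>2 * r))"
      using assms r e0 by (intro divide_left_mono mult_left_mono mult_pos_pos) (auto simp: power2_eq_square)
    finally have 1: "exp (- N * osc t) \<le> 5000 / (N\<^sup>2 * (e\<^sup>2 * r))" .
    have "pi * 1 \<le> pi * p"
      using assms by (intro mult_left_mono) auto
    moreover have "3 * real p \<le> pi * p"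
      using pi_gt3 by (intro mult_right_mono) auto
    ultimately have t3: "3 * real p \<le> t"
      using that unfolding atLeastAtMost_iff by linarith
    moreover have "0 < 3 * real p"
      using assms by simp
    ultimately have t0: "0 < t"
      by linarith
    \<comment> \<open>The weight \<open>1 / t\<close> is traded for a factor \<open>e\<close>, which is possible because \<open>e \<ge> 1 / (4 p)\<close>.\<close>
    have "1 / t \<le> 1 / (3 * p)"
      using t3 t0 assms by (intro divide_left_mono) auto
    also have "\<dots> = 4 / 3 * (1 / (4 * p))"
      by simp
    also have "\<dots> \<le> 4 / 3 * e"
      using e4 by (intro mult_left_mono) auto
    finally have "exp (- N * osc t) * (1 / t) \<le> 5000 / (N\<^sup>2 * (e\<^sup>2 * r)) * (4 / 3 * e)"
      using 1 t0 r by (intro mult_mono) auto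
    also have "\<dots> = 20000 / 3 * (1 / (N\<^sup>2 * (e * r)))"
      using e0 by (simp add: power2_eq_square)
    also have "\<dots> \<le> 6700 * (1 / (N\<^sup>2 * (e * r)))"
      using e0 r by (intro mult_right_mono) auto
    finally show ?thesis
      by (simp add: r_def)
  qed
  have "(\<integral>\<^sup>+t\<in>{?c - pi..?c + pi}. ennreal (exp (- N * osc t) / t) \<partial>lborel)
      \<le> (\<integral>\<^sup>+t. ennreal (?K * (1 / ((t - ?c)\<^sup>2 + e\<^sup>2))) * indicator {?c - pi..?c + pi} t \<partial>lborel)"
    using bound by (intro nn_integral_mono) (auto simp: indicator_def intro!: ennreal_leI)
  also have "\<dots> = ennreal (?K * ?F (?c + pi) - ?K * ?F (?c - pi))"
  proof (rule nn_integral_FTC_Icc[where F = "\<lambda>t. ?K * ?F t" and f = "\<lambda>t. ?K * (1 / ((t - ?c)\<^sup>2 + e\<^sup>2))"])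
    fix t
    have *: "inverse (1 + ((t - ?c) / e)\<^sup>2) = e\<^sup>2 / ((t - ?c)\<^sup>2 + e\<^sup>2)"
    proof -
      have "1 + ((t - ?c) / e)\<^sup>2 = ((t - ?c)\<^sup>2 + e\<^sup>2) / e\<^sup>2"
        using e0 by (simp add: power_divide add_divide_distrib add.commute)
      then show ?thesis
        by simp
    qed
    show "((\<lambda>t. ?K * ?F t) has_real_derivative ?K * (1 / ((t - ?c)\<^sup>2 + e\<^sup>2))) (at t)"
      using e0 assms
      by (auto intro!: derivative_eq_intros simp: *) (simp_all add: power2_eq_square)
    show "0 \<le> ?K * (1 / ((t - ?c)\<^sup>2 + e\<^sup>2))"
      using e0 by simp
  qed auto
  also have "?K * ?F (?c + pi) - ?K * ?F (?c - pi) = ?K * (2 * arctan (pi / e) / e)"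
    by (simp add: arctan_minus algebra_simps flip: minus_divide_left)
  also have "\<dots> \<le> ?K * (4 / e)"
    using e0 arctan_ubound[of "pi / e"] pi_less_4 by (intro mult_left_mono divide_right_mono) auto
  also have "\<dots> = 26800 / (N\<^sup>2 * (sqrt2_frac p)\<^sup>2)"
    by (simp add: e_def power2_eq_square)
  also have "\<dots> \<le> 27000 / (N\<^sup>2 * (sqrt2_frac p)\<^sup>2)"
    by (intro divide_right_mono) auto
  finally show ?thesis
    by (simp add: ennreal_leI)
qed

text \<open>The range is covered by the periods around \<open>2 * pi * p\<close>, and the bounds for
  the single periods are summed by \<open>sum_inverse_sqrt2_frac_squares\<close>. The constant comes
  from \<open>27000 * 64 * 4 = 6912000\<close>.\<close>

lemma nn_integral_osc:
  assumes "0 < N"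
  shows "(\<integral>\<^sup>+t\<in>{pi<..L}. ennreal (exp (- N * osc t) / t) \<partial>lborel) \<le> ennreal (10 ^ 7 * L\<^sup>2 / N\<^sup>2)"
proof (cases "L \<le> pi")
  case False
  define P where "P = nat \<lceil>L\<rceil>"
  have L: "3 < L"
    using False pi_gt3 by simp
  have P: "L \<le> P" "P \<le> 2 * L"
    using L unfolding P_def by linarith+
  let ?I = "\<lambda>p::nat. {2 * pi * p - pi..2 * pi * p + pi}"
  let ?f = "\<lambda>t. ennreal (exp (- N * osc t) / t)"
  have cover: "\<exists>p\<in>{1..P}. t \<in> ?I p" if "t \<in> {pi<..L}" for t
  proof (intro bexI)
    \<comment> \<open>The period containing \<open>t\<close> is found by rounding;
      \<open>t > pi\<close> makes the rounded number positive, and it is at most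
      \<open>L / 2 + 1 / 2\<close>, hence at most \<open>P\<close>.\<close>
    define p where "p = nat (round (t / (2 * pi)))"
    have r: "\<bar>of_int (round (t / (2 * pi))) - t / (2 * pi)\<bar> \<le> 1 / 2"
      by (rule of_int_round_abs_le)
    have t: "1 / 2 < t / (2 * pi)" "t / (2 * pi) \<le> t / 2"
      using that pi_gt3 by (auto simp: field_simps)
    have "0 < real_of_int (round (t / (2 * pi)))" 
      using r t by linarith
    then have r0: "0 < round (t / (2 * pi))"
      by simp
    then have pr: "real p = of_int (round (t / (2 * pi)))"
      by (simp add: p_def)
    have "\<bar>real p - t / (2 * pi)\<bar> * (2 * pi) \<le> 1 / 2 * (2 * pi)"
      using r unfolding pr by (intro mult_right_mono) auto
    also have "\<bar>real p - t / (2 * pi)\<bar> * (2 * pi) = \<bar>(real p - t / (2 * pi)) * (2 * pi)\<bar>"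
      by (simp add: abs_mult)
    also have "(real p - t / (2 * pi)) * (2 * pi) = 2 * pi * real p - t"
      by (simp add: field_simps)
    finally show "t \<in> ?I p"
      by auto
    have "t \<le> L"
      using that by simp
    then have "real p \<le> P"
      using r t P L unfolding pr by linarith
    moreover have "0 < p"
      using r0 unfolding p_def by simp
    ultimately show "p \<in> {1..P}"
      by simp
  qed
  have "(\<integral>\<^sup>+t\<in>{pi<..L}. ?f t \<partial>lborel) \<le> (\<integral>\<^sup>+t. (\<Sum>p\<in>{1..P}. ?f t * indicator (?I p) t) \<partial>lborel)"
  proof (intro nn_integral_mono)
    fix t
    show "?f t * indicator {pi<..L} t \<le> (\<Sum>p\<in>{1..P}. ?f t * indicator (?I p) t)"
    proof (cases "t \<in> {pi<..L}")
      case True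
      then obtain p where p: "p \<in> {1..P}" "t \<in> ?I p"
        using cover by blast
      have "?f t * indicator {pi<..L} t = ?f t * indicator (?I p) t"
        using True p(2) by simp
      also have "\<dots> \<le> (\<Sum>p\<in>{1..P}. ?f t * indicator (?I p) t)"
        using p(1) by (intro member_le_sum) auto
      finally show ?thesis .
    qed simp
  qed
  also have "\<dots> = (\<Sum>p\<in>{1..P}. \<integral>\<^sup>+t\<in>?I p. ?f t \<partial>lborel)"
    by (intro nn_integral_sum) measurable
  also have "\<dots> \<le> (\<Sum>p\<in>{1..P}. ennreal (27000 / N\<^sup>2 * (1 / (sqrt2_frac p)\<^sup>2)))"
    using assms by (intro sum_mono nn_integral_osc_period) auto
  also have "\<dots> = ennreal (27000 / N\<^sup>2 * (\<Sum>p\<in>{1..P}. 1 / (sqrt2_frac p)\<^sup>2))"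
    by (simp add: sum_ennreal sum_distrib_left)
  also have "\<dots> \<le> ennreal (27000 / N\<^sup>2 * (64 * (2 * L)\<^sup>2))"
    using P by (intro ennreal_leI mult_left_mono order_trans[OF sum_inverse_sqrt2_frac_squares] power_mono) auto
  also have "\<dots> \<le> ennreal (10 ^ 7 * L\<^sup>2 / N\<^sup>2)"
    by (intro ennreal_leI) (simp add: power_mult_distrib divide_right_mono)
  finally show ?thesis .
qed simp

section \<open>Esseen's smoothing inequality\<close>

text \<open>The Fejer kernel without normalization, that is, the cosine transform of the triangle
  \<open>1 - t\<close> on the unit interval. The value at 0 is its limit there.\<close>

definition fejer :: "real \<Rightarrow> real" where
  "fejer u = (if u = 0 then 1 / 2 else (1 - cos u) / u\<^sup>2)"

lemma fejer_nonneg: "0 \<le> fejer u"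
  by (simp add: fejer_def)

lemma fejer_measurable [measurable]: "fejer \<in> borel_measurable borel"
  unfolding fejer_def[abs_def] by measurable

text \<open>Domination by a Cauchy density, which makes the kernel integrable. Near 0 the half-angle
  formula bounds it by 1, elsewhere it is at most \<open>2 / u^2\<close>.\<close>

lemma fejer_le: "fejer u \<le> 4 * inverse (1 + u\<^sup>2)"
proof (cases "\<bar>u\<bar> \<le> 1")
  case True
  have u1: "u\<^sup>2 \<le> 1"
    using True abs_le_square_iff[of u 1] by simp
  have "\<bar>sin (u / 2)\<bar> \<le> \<bar>u / 2\<bar>"
    by (rule abs_sin_x_le_abs_x)
  then have "(sin (u / 2))\<^sup>2 \<le> (u / 2)\<^sup>2"
    by (simp only: abs_le_square_iff)
  moreover have "cos u = 1 - 2 * (sin (u / 2))\<^sup>2"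
    using cos_double_sin[of "u / 2"] by simp
  moreover have "(u / 2)\<^sup>2 = u\<^sup>2 / 4"
    by (simp add: power_divide)
  ultimately have "1 - cos u \<le> u\<^sup>2"
    using zero_le_power2[of "sin (u / 2)"] by linarith
  then have "fejer u \<le> 1"
    by (auto simp: fejer_def divide_le_eq)
  also have "1 \<le> 4 * inverse (1 + u\<^sup>2)"
    using u1 by (simp add: field_simps add_pos_nonneg)
  finally show ?thesis .
next
  case False
  then have u: "1 \<le> u\<^sup>2" "u \<noteq> 0"
    using abs_le_square_iff[of 1 u] by auto
  have "fejer u \<le> 2 / u\<^sup>2"
    using u cos_ge_minus_one[of u] unfolding fejer_def by (auto intro!: divide_right_mono)
  also have "\<dots> \<le> 4 * inverse (1 + u\<^sup>2)"
    using u by (simp add: field_simps add_pos_nonneg)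
  finally show ?thesis .
qed

lemma fejer_integrable: "integrable lborel fejer"
proof (rule Bochner_Integration.integrable_bound)
  show "integrable lborel (\<lambda>u::real. 4 * inverse (1 + u\<^sup>2))"
    using integrable_inverse_1_plus_square by (simp add: set_integrable_def)
  show "AE u in lborel. norm (fejer u) \<le> norm (4 * inverse (1 + u\<^sup>2))"
    using fejer_le fejer_nonneg by (auto simp: add_pos_nonneg intro!: AE_I2)
qed measurable

definition fejer_mass :: real where
  "fejer_mass = (\<integral>u. fejer u \<partial>lborel)"

lemma fejer_mass_pos: "0 < fejer_mass"
proof -
  \<comment> \<open>The constant is \<open>1 / 2 - 1 / 24\<close>, from the fourth order Taylor
    bound and \<open>u^4 \<le> u^2\<close> on the unit interval.\<close>
  have "(\<integral>u. 11 / 24 * indicator {0..1::real} u \<partial>lborel) \<le> fejer_mass"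
    unfolding fejer_mass_def
  proof (rule integral_mono)
    fix u :: real
    show "11 / 24 * indicator {0..1} u \<le> fejer u"
    proof (cases "u \<in> {0<..1}")
      case True
      then have "u ^ 4 \<le> u\<^sup>2" 
        by (auto intro!: power_decreasing)
      then have "11 / 24 * u\<^sup>2 \<le> 1 - cos u"
        using cos_approx4[of u] unfolding abs_le_iff by linarith
      then show ?thesis
        using True by (auto simp: fejer_def field_simps)
    next
      case False
      then show ?thesis
        using fejer_nonneg[of u] by (auto simp: indicator_def fejer_def)
    qed
  qed (auto intro: fejer_integrable)
  then show ?thesis by simp
qed

definition fejer_distribution :: "real measure" where
  "fejer_distribution = density lborel (\<lambda>u. ennreal (fejer u / fejer_mass))"

lemma real_distribution_fejer: "real_distribution fejer_distribution"
proof -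
  have "(\<integral>\<^sup>+u. ennreal (fejer u / fejer_mass) \<partial>lborel) = ennreal (\<integral>u. fejer u / fejer_mass \<partial>lborel)"
    using fejer_mass_pos fejer_nonneg fejer_integrable by (intro nn_integral_eq_integral) auto
  also have "(\<integral>u. fejer u / fejer_mass \<partial>lborel) = 1"
    using fejer_mass_pos by (simp flip: fejer_mass_def)
  finally have "prob_space fejer_distribution"
    by (auto intro!: prob_spaceI simp: fejer_distribution_def emeasure_density)
  then show ?thesis
    by (simp add: real_distribution_def real_distribution_axioms_def fejer_distribution_def)
qed

text \<open>The singularity \<open>1 / t\<close> is harmless because the sine vanishes at 0. The
  majorant is linear in \<open>y\<close>, which is why laws with a first moment are admissible in
  the Fubini argument below.\<close>

lemma abs_fejer_transform_le: "\<bar>(1 - t) * (sin (t * y) / t) * indicator {0..1} t\<bar> \<le> \<bar>y\<bar> * indicator {0..1} t"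
  for y t :: real
proof -
  have "\<bar>sin (t * y) / t\<bar> \<le> \<bar>y\<bar>"
    using abs_sin_x_le_abs_x[of "t * y"] by (cases "t = 0") (auto simp: abs_mult divide_le_eq mult.commute)
  then have "\<bar>1 - t\<bar> * \<bar>sin (t * y) / t\<bar> \<le> 1 * \<bar>y\<bar>" if "t \<in> {0..1}"
    using that by (intro mult_mono) auto
  then show ?thesis
    by (simp add: indicator_def abs_mult)
qed

lemma set_integrable_fejer_transform: "set_integrable lborel {0..1} (\<lambda>t. (1 - t) * (sin (t * y) / t))"
  for y :: real
  unfolding set_integrable_def
proof (rule Bochner_Integration.integrable_bound)
  show "integrable lborel (\<lambda>t. \<bar>y\<bar> * indicator {0..1::real} t)"
    by auto
  show "AE t in lborel. norm (indicator {0..1} t *\<^sub>R ((1 - t) * (sin (t * y) / t)))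
      \<le> norm (\<bar>y\<bar> * indicator {0..1} t)"
    using abs_fejer_transform_le by (intro AE_I2) (simp add: mult.commute)
qed measurable

text \<open>Up to normalization and an additive constant this is the distribution function of the Fejer kernel,
  written as an integral over the compact spectrum of the kernel; no Fourier inversion is needed.\<close>

definition fejer_transform :: "real \<Rightarrow> real" where
  "fejer_transform y = (LBINT t:{0..1}. (1 - t) * (sin (t * y) / t))"

text \<open>Integration by parts gives the antiderivative; it divides by \<open>u\<close>, so
  \<open>u = 0\<close> is treated separately.\<close>

lemma fejer_eq_integral: "((\<lambda>t. (1 - t) * cos (t * u)) has_integral fejer u) {0..1}"
proof (cases "u = 0")
  case True
  have "((\<lambda>t. 1 - t) has_integral (1 - 1\<^sup>2 / 2) - (0 - 0\<^sup>2 / 2)) {0..1::real}"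
    by (intro fundamental_theorem_of_calculus)
      (auto intro!: derivative_eq_intros simp flip: has_real_derivative_iff_has_vector_derivative)
  then show ?thesis
    using True by (simp add: fejer_def)
next
  case False
  let ?F = "\<lambda>t. (1 - t) * sin (t * u) / u - cos (t * u) / u\<^sup>2"
  have "((\<lambda>t. (1 - t) * cos (t * u)) has_integral ?F 1 - ?F 0) {0..1}"
    using False
    by (intro fundamental_theorem_of_calculus)
      (auto intro!: derivative_eq_intros simp: power2_eq_square field_simps
        simp flip: has_real_derivative_iff_has_vector_derivative)
  moreover have "?F 1 - ?F 0 = fejer u"
    using False by (simp add: fejer_def diff_divide_distrib)
  ultimately show ?thesis by simp
qed

lemma fejer_transform_deriv: "(fejer_transform has_real_derivative fejer y) (at y)"
proof -
  let ?f = "\<lambda>y t. (1 - t) * (sin (t * y) / t)"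
  have eq: "fejer_transform y = integral {0..1} (?f y)" for y
    unfolding fejer_transform_def by (rule set_borel_integral_eq_integral(2)[OF set_integrable_fejer_transform])
  \<comment> \<open>Division by zero makes the integrand 0 at \<open>t = 0\<close>, with
    \<open>y\<close>-derivative 0 instead of the required 1. Redefining it as \<open>y\<close> there
    makes differentiation under the integral applicable and changes only a null set.\<close>
  have 1: "((\<lambda>y. integral (cbox 0 1) (\<lambda>t. if t = 0 then y else ?f y t)) has_field_derivative
      integral (cbox 0 1) (\<lambda>t. (1 - t) * cos (t * y))) (at y within UNIV)"
  proof (rule leibniz_rule_field_derivative)
    fix y t :: real
    show "((\<lambda>y. if t = 0 then y else ?f y t) has_field_derivative (1 - t) * cos (t * y)) (at y within UNIV)"
      by (cases "t = 0") (auto intro!: derivative_eq_intros)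
  next
    fix y :: real
    have "?f y integrable_on {0..1}"
      by (rule set_borel_integral_eq_integral(1)[OF set_integrable_fejer_transform])
    then show "(\<lambda>t. if t = 0 then y else ?f y t) integrable_on cbox 0 1"
      unfolding box_real by (rule integrable_spike[of _ _ "{0}"]) auto
  next
    show "continuous_on (UNIV \<times> cbox 0 1) (\<lambda>(y, t). (1 - t) * cos (t * y :: real))"
      by (auto intro!: continuous_intros simp: case_prod_unfold)
  qed auto
  have 2: "integral {0..1} (\<lambda>t. if t = 0 then y else ?f y t) = fejer_transform y" for y
    unfolding eq by (rule integral_spike[of "{0}"]) auto
  have 3: "integral {0..1} (\<lambda>t. (1 - t) * cos (t * y)) = fejer y"
    using fejer_eq_integral by (rule integral_unique)
  show ?thesis
    using 1 unfolding box_real 2 3 .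
qed

text \<open>Both sides have the same increments by the fundamental theorem of calculus, and
  \<open>fejer_transform 0 = 0\<close> fixes the constant.\<close>

lemma cdf_fejer: "cdf fejer_distribution y = cdf fejer_distribution 0 + fejer_transform y / fejer_mass"
proof -
  interpret real_distribution fejer_distribution
    by (rule real_distribution_fejer)
  have diff: "cdf fejer_distribution b - cdf fejer_distribution a
      = (fejer_transform b - fejer_transform a) / fejer_mass" if "a \<le> b" for a b
  proof (cases "a = b")
    case False
    then have "a < b" using that by simp
    then have cdf: "cdf fejer_distribution b - cdf fejer_distribution a = measure fejer_distribution {a<..b}"
      by (rule cdf_diff_eq)
    have "emeasure fejer_distribution {a<..b} = (\<integral>\<^sup>+u\<in>{a..b}. ennreal (fejer u / fejer_mass) \<partial>lborel)"
      unfolding fejer_distribution_def using AE_lborel_singleton[of a]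
      by (subst emeasure_density) (auto intro!: nn_integral_cong_AE simp: indicator_def)
    also have "\<dots> = ennreal (fejer_transform b / fejer_mass - fejer_transform a / fejer_mass)"
      using that fejer_mass_pos fejer_nonneg
      by (intro nn_integral_FTC_Icc) (auto intro!: DERIV_cdivide fejer_transform_deriv)
    finally have "measure fejer_distribution {a<..b}
        = enn2real (ennreal ((fejer_transform b - fejer_transform a) / fejer_mass))"
      unfolding measure_def by (simp add: diff_divide_distrib)
    moreover have "fejer_transform a \<le> fejer_transform b"
      using that by (rule DERIV_nonneg_imp_nondecreasing) (use fejer_transform_deriv fejer_nonneg in blast)
    ultimately show ?thesis
      using cdf fejer_mass_pos by simp
  qed simp
  have "fejer_transform 0 = 0"
    by (simp add: fejer_transform_def set_lebesgue_integral_def)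
  then show ?thesis
    using diff[of 0 y] diff[of y 0] by (cases "0 \<le> y") (auto simp: diff_divide_distrib)
qed

lemma fejer_transform_measurable [measurable]: "fejer_transform \<in> borel_measurable borel"
  using fejer_transform_deriv
  by (intro borel_measurable_continuous_onI continuous_at_imp_continuous_on ballI DERIV_isCont)

text \<open>Fubini's theorem for the integral defining \<open>fejer_transform\<close>. Joint
  integrability follows from the majorant \<open>\<bar>T * (a - x)\<bar>\<close>, integrable because
  the law has a first moment.\<close>

lemma (in real_distribution) integral_fejer_transform:
  assumes [simp]: "integrable M (\<lambda>x. x)"
  shows "integrable M (\<lambda>x. fejer_transform (T * (a - x)))"
    and "set_integrable lborel {0..1} (\<lambda>t. (1 - t) * ((\<integral>x. sin (t * (T * (a - x))) \<partial>M) / t))"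
    and "(\<integral>x. fejer_transform (T * (a - x)) \<partial>M)
      = (LBINT t:{0..1}. (1 - t) * ((\<integral>x. sin (t * (T * (a - x))) \<partial>M) / t))"
proof -
  let ?f = "\<lambda>(x, t). (1 - t) * (sin (t * (T * (a - x))) / t) * indicator {0..1} t"
  interpret P: pair_sigma_finite M lborel ..
  have meas: "?f \<in> borel_measurable (M \<Otimes>\<^sub>M lborel)"
    by measurable
  have int1: "integrable lborel (\<lambda>t. ?f (x, t))" for x
    using set_integrable_fejer_transform[of "T * (a - x)"]
    by (simp add: set_integrable_def mult.commute)
  have "integrable (M \<Otimes>\<^sub>M lborel) ?f"
  proof (rule P.Fubini_integrable[OF meas])
    show "integrable M (\<lambda>x. \<integral>t. norm (?f (x, t)) \<partial>lborel)"
    proof (rule Bochner_Integration.integrable_bound)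
      show "integrable M (\<lambda>x. \<bar>T * (a - x)\<bar>)"
        by auto
      show "AE x in M. norm (\<integral>t. norm (?f (x, t)) \<partial>lborel) \<le> norm \<bar>T * (a - x)\<bar>"
      proof (intro AE_I2)
        fix x
        have "(\<integral>t. norm (?f (x, t)) \<partial>lborel) \<le> (\<integral>t. \<bar>T * (a - x)\<bar> * indicator {0..1::real} t \<partial>lborel)"
        proof (rule Bochner_Integration.integral_mono)
          show "integrable lborel (\<lambda>t. norm (?f (x, t)))"
            using int1 by (rule integrable_norm)
          show "norm (?f (x, t)) \<le> \<bar>T * (a - x)\<bar> * indicator {0..1} t" for t
            using abs_fejer_transform_le[of t "T * (a - x)"] by simp
        qed simp
        then show "norm (\<integral>t. norm (?f (x, t)) \<partial>lborel) \<le> norm \<bar>T * (a - x)\<bar>"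
          by simp
      qed
      show "(\<lambda>x. \<integral>t. norm (?f (x, t)) \<partial>lborel) \<in> borel_measurable M"
        using meas by (intro lborel.borel_measurable_lebesgue_integral) simp
    qed
    show "AE x in M. integrable lborel (\<lambda>t. ?f (x, t))"
      using int1 by simp
  qed
  then have int: "integrable (M \<Otimes>\<^sub>M lborel) (\<lambda>(x, t). ?f (x, t))"
    by simp
  have t: "fejer_transform (T * (a - x)) = (\<integral>t. ?f (x, t) \<partial>lborel)" for x
    by (simp add: fejer_transform_def set_lebesgue_integral_def mult.commute)
  have x: "indicator {0..1} t *\<^sub>R ((1 - t) * ((\<integral>x. sin (t * (T * (a - x))) \<partial>M) / t))
      = (\<integral>x. ?f (x, t) \<partial>M)" for t
    by simp
  show "integrable M (\<lambda>x. fejer_transform (T * (a - x)))"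
    unfolding t using P.integrable_fst[OF int] by simp
  show "set_integrable lborel {0..1} (\<lambda>t. (1 - t) * ((\<integral>x. sin (t * (T * (a - x))) \<partial>M) / t))"
    unfolding set_integrable_def x using P.integrable_snd[OF int] by simp
  show "(\<integral>x. fejer_transform (T * (a - x)) \<partial>M)
      = (LBINT t:{0..1}. (1 - t) * ((\<integral>x. sin (t * (T * (a - x))) \<partial>M) / t))"
    unfolding set_lebesgue_integral_def t x using P.Fubini_integral[OF int] by simp
qed

lemma (in real_distribution) integral_sin_eq_char:
  "(\<integral>x. sin (s * (a - x)) \<partial>M) = - Im (iexp (- (s * a)) * char M s)"
proof -
  have "(\<integral>x. sin (s * (a - x)) \<partial>M) = (\<integral>x. - Im (iexp (- (s * a)) * iexp (s * x)) \<partial>M)"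
    by (intro Bochner_Integration.integral_cong refl)
      (simp add: Im_exp sin_diff flip: exp_add, simp add: algebra_simps sin_diff cos_diff sin_add)
  also have "\<dots> = - Im (\<integral>x. iexp (- (s * a)) * iexp (s * x) \<partial>M)"
    by (subst integral_minus, subst integral_Im) (auto intro!: integrable_mult_right integrable_iexp)
  also have "\<dots> = - Im (iexp (- (s * a)) * char M s)"
    unfolding char_def by (subst integral_mult_right_zero) (rule refl)
  finally show ?thesis .
qed

lemma integral_sin_diff_le:
  assumes "real_distribution \<mu>" "real_distribution \<nu>"
  shows "\<bar>(\<integral>x. sin (s * (a - x)) \<partial>\<mu>) - (\<integral>x. sin (s * (a - x)) \<partial>\<nu>)\<bar> \<le> cmod (char \<mu> s - char \<nu> s)"
proof -
  have "\<bar>(\<integral>x. sin (s * (a - x)) \<partial>\<mu>) - (\<integral>x. sin (s * (a - x)) \<partial>\<nu>)\<bar>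
      = \<bar>Im (iexp (- (s * a)) * (char \<mu> s - char \<nu> s))\<bar>"
    unfolding real_distribution.integral_sin_eq_char[OF assms(1)]
      real_distribution.integral_sin_eq_char[OF assms(2)]
    by (simp only: right_diff_distrib minus_complex.sel abs_minus_commute)
  also have "\<dots> \<le> cmod (iexp (- (s * a)) * (char \<mu> s - char \<nu> s))"
    by (rule abs_Im_le_cmod)
  also have "\<dots> = cmod (char \<mu> s - char \<nu> s)"
    by (simp only: norm_mult norm_exp_i_times mult_1)
  finally show ?thesis .
qed

text \<open>The measure \<open>dt / t\<close> is invariant under dilations, so no Jacobian
  remains.\<close>

lemma nn_integral_Ioc_scale:
  fixes f :: "real \<Rightarrow> real"
  assumes "0 < c" and [measurable]: "f \<in> borel_measurable borel"
  shows "(\<integral>\<^sup>+t\<in>{a<..b}. ennreal (f t / t) \<partial>lborel) = (\<integral>\<^sup>+t\<in>{a / c<..b / c}. ennreal (f (c * t) / t) \<partial>lborel)"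
proof -
  have "(\<integral>\<^sup>+t\<in>{a<..b}. ennreal (f t / t) \<partial>lborel)
      = ennreal c * (\<integral>\<^sup>+t. ennreal (f (c * t) / (c * t)) * indicator {a<..b} (c * t) \<partial>lborel)"
    using assms by (subst nn_integral_real_affine[where c = c and t = 0]) auto
  also have "\<dots> = (\<integral>\<^sup>+t. ennreal c * (ennreal (f (c * t) / (c * t)) * indicator {a<..b} (c * t)) \<partial>lborel)"
    by (intro nn_integral_cmult[symmetric]) measurable
  also have "\<dots> = (\<integral>\<^sup>+t\<in>{a / c<..b / c}. ennreal (f (c * t) / t) \<partial>lborel)"
  proof (intro nn_integral_cong)
    fix t
    have "ennreal c * ennreal (f (c * t) / (c * t)) = ennreal (f (c * t) / t)"
      using assms by (subst ennreal_mult'[symmetric]) auto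
    moreover have "indicator {a<..b} (c * t) = (indicator {a / c<..b / c} t :: ennreal)"
      using assms by (auto simp: indicator_def field_simps)
    ultimately show "ennreal c * (ennreal (f (c * t) / (c * t)) * indicator {a<..b} (c * t))
        = ennreal (f (c * t) / t) * indicator {a / c<..b / c} t"
      by (simp add: mult.assoc[symmetric])
  qed
  finally show ?thesis .
qed

text \<open>Smoothing at scale \<open>1 / T\<close> leaves only frequencies up to \<open>T\<close>:
  the smoothed distribution function is an average of \<open>fejer_transform (T * (a - x))\<close>
  plus a constant that cancels in the difference. The triangle weight is then bounded by 1.\<close>

lemma fejer_smoothed_difference:
  assumes "real_distribution \<mu>" "integrable \<mu> (\<lambda>x. x)" "real_distribution \<nu>" "integrable \<nu> (\<lambda>x. x)"
    and "0 < T" "0 \<le> \<epsilon>"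
    and \<epsilon>: "(\<integral>\<^sup>+t\<in>{0<..T}. ennreal (cmod (char \<mu> t - char \<nu> t) / t) \<partial>lborel) \<le> ennreal \<epsilon>"
  shows "\<bar>(\<integral>u. cdf \<mu> (a - u / T) - cdf \<nu> (a - u / T) \<partial>fejer_distribution)\<bar> \<le> \<epsilon> / fejer_mass"
proof -
  interpret K: real_distribution fejer_distribution
    by (rule real_distribution_fejer)
  have smooth: "integrable fejer_distribution (\<lambda>u. cdf \<rho> (a - u / T))"
      "(\<integral>u. cdf \<rho> (a - u / T) \<partial>fejer_distribution)
        = cdf fejer_distribution 0 + (\<integral>x. fejer_transform (T * (a - x)) \<partial>\<rho>) / fejer_mass"
    if \<rho>: "real_distribution \<rho>" "integrable \<rho> (\<lambda>x. x)" for \<rho>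
  proof -
    interpret R: real_distribution \<rho>
      by (rule \<rho>)
    interpret P: pair_prob_space \<rho> fejer_distribution ..
    \<comment> \<open>Integrating the event \<open>x + u / T \<le> a\<close> first over
      \<open>x\<close> gives the smoothed distribution function of \<open>\<rho>\<close>, first over
      \<open>u\<close> the distribution function of the kernel at
      \<open>T * (a - x)\<close>.\<close>
    let ?g = "\<lambda>(x, u). indicator {..a} (x + u / T) :: real"
    have meas: "?g \<in> borel_measurable (\<rho> \<Otimes>\<^sub>M fejer_distribution)"
      by measurable
    have int: "integrable (\<rho> \<Otimes>\<^sub>M fejer_distribution) ?g"
      using meas by (intro P.integrable_const_bound[where B = 1]) (auto simp: indicator_def)
    have u: "(\<integral>x. ?g (x, u) \<partial>\<rho>) = cdf \<rho> (a - u / T)" for u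
    proof -
      have "(\<integral>x. ?g (x, u) \<partial>\<rho>) = (\<integral>x. indicator {..a - u / T} x \<partial>\<rho>)"
        by (intro Bochner_Integration.integral_cong refl) (auto simp: indicator_def)
      then show ?thesis
        by (simp add: cdf_def)
    qed
    have x: "(\<integral>u. ?g (x, u) \<partial>fejer_distribution)
        = cdf fejer_distribution 0 + fejer_transform (T * (a - x)) / fejer_mass" for x
    proof -
      have "(\<integral>u. ?g (x, u) \<partial>fejer_distribution) = (\<integral>u. indicator {..T * (a - x)} u \<partial>fejer_distribution)"
        using assms by (intro Bochner_Integration.integral_cong refl) (auto simp: indicator_def field_simps)
      then show ?thesis
        using cdf_fejer[of "T * (a - x)"] by (simp add: cdf_def)
    qed
    have int': "integrable (\<rho> \<Otimes>\<^sub>M fejer_distribution) (\<lambda>(x, u). ?g (x, u))"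
      using int by simp
    show "integrable fejer_distribution (\<lambda>u. cdf \<rho> (a - u / T))"
      using P.integrable_snd[OF int'] unfolding u by simp
    have "(\<integral>u. cdf \<rho> (a - u / T) \<partial>fejer_distribution)
        = (\<integral>x. cdf fejer_distribution 0 + fejer_transform (T * (a - x)) / fejer_mass \<partial>\<rho>)"
      using P.Fubini_integral[OF int'] unfolding u x by simp
    also have "\<dots> = cdf fejer_distribution 0 + (\<integral>x. fejer_transform (T * (a - x)) \<partial>\<rho>) / fejer_mass"
      using R.integral_fejer_transform(1)[OF \<rho>(2)] R.prob_space by simp
    finally show "(\<integral>u. cdf \<rho> (a - u / T) \<partial>fejer_distribution)
        = cdf fejer_distribution 0 + (\<integral>x. fejer_transform (T * (a - x)) \<partial>\<rho>) / fejer_mass" .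
  qed
  let ?E = "\<lambda>\<rho> t. \<integral>x. sin (t * (T * (a - x))) \<partial>\<rho>"
  let ?d = "\<lambda>t. (1 - t) * (?E \<mu> t / t) - (1 - t) * (?E \<nu> t / t)"
  have int_d: "set_integrable lborel {0..1} ?d"
    by (intro set_integral_diff real_distribution.integral_fejer_transform(2) assms)
  have eq: "(\<integral>u. cdf \<mu> (a - u / T) - cdf \<nu> (a - u / T) \<partial>fejer_distribution)
      = (LBINT t:{0..1}. ?d t) / fejer_mass"
  proof -
    have "(\<integral>u. cdf \<mu> (a - u / T) - cdf \<nu> (a - u / T) \<partial>fejer_distribution)
        = (\<integral>x. fejer_transform (T * (a - x)) \<partial>\<mu>) / fejer_mass
          - (\<integral>x. fejer_transform (T * (a - x)) \<partial>\<nu>) / fejer_mass"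
      using smooth[OF assms(1,2)] smooth[OF assms(3,4)] by simp
    also have "(\<integral>x. fejer_transform (T * (a - x)) \<partial>\<mu>) = (LBINT t:{0..1}. (1 - t) * (?E \<mu> t / t))"
      by (rule real_distribution.integral_fejer_transform(3)[OF assms(1,2)])
    also have "(\<integral>x. fejer_transform (T * (a - x)) \<partial>\<nu>) = (LBINT t:{0..1}. (1 - t) * (?E \<nu> t / t))"
      by (rule real_distribution.integral_fejer_transform(3)[OF assms(3,4)])
    also have "(LBINT t:{0..1}. (1 - t) * (?E \<mu> t / t)) / fejer_mass
        - (LBINT t:{0..1}. (1 - t) * (?E \<nu> t / t)) / fejer_mass = (LBINT t:{0..1}. ?d t) / fejer_mass"
      unfolding diff_divide_distrib[symmetric]
      by (subst set_integral_diff(2)) (intro real_distribution.integral_fejer_transform(2) assms refl)+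
    finally show ?thesis .
  qed
  have [measurable]: "char \<mu> \<in> borel_measurable borel" "char \<nu> \<in> borel_measurable borel"
    using assms by (auto intro: real_distribution.char_measurable)
  have "ennreal \<bar>LBINT t:{0..1}. ?d t\<bar> \<le> (\<integral>\<^sup>+t. norm (indicator {0..1} t *\<^sub>R ?d t) \<partial>lborel)"
    using integral_norm_bound_ennreal[OF int_d[unfolded set_integrable_def]]
    by (simp add: set_lebesgue_integral_def)
  also have "\<dots> \<le> (\<integral>\<^sup>+t\<in>{0 / T<..T / T}. ennreal (cmod (char \<mu> (T * t) - char \<nu> (T * t)) / t) \<partial>lborel)"
  proof (intro nn_integral_mono)
    fix t :: real
    show "ennreal (norm (indicator {0..1} t *\<^sub>R ?d t))
        \<le> ennreal (cmod (char \<mu> (T * t) - char \<nu> (T * t)) / t) * indicator {0 / T<..T / T} t"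
    proof (cases "t \<in> {0<..1}")
      case True
      have "\<bar>?E \<mu> t - ?E \<nu> t\<bar> \<le> cmod (char \<mu> (T * t) - char \<nu> (T * t))"
        using integral_sin_diff_le[OF assms(1,3), of "T * t" a] by (simp add: mult_ac)
      then have "(1 - t) * \<bar>?E \<mu> t - ?E \<nu> t\<bar> \<le> 1 * cmod (char \<mu> (T * t) - char \<nu> (T * t))"
        using True by (intro mult_mono) auto
      moreover have "\<bar>?d t\<bar> = (1 - t) * \<bar>?E \<mu> t - ?E \<nu> t\<bar> / t"
      proof -
        have "?d t = (1 - t) * (?E \<mu> t - ?E \<nu> t) / t"
          by (simp add: diff_divide_distrib right_diff_distrib)
        then show ?thesis
          using True by (simp add: abs_mult)
      qed
      ultimately have "\<bar>?d t\<bar> \<le> cmod (char \<mu> (T * t) - char \<nu> (T * t)) / t"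
        using True by (simp add: divide_right_mono)
      then show ?thesis
        using True assms by (simp add: ennreal_leI)
    next
      \<comment> \<open>Only \<open>t = 0\<close> remains inside the indicator of the closed
        interval, and there the quotients are 0 by the convention for division by zero.\<close>
      case False
      then have zero: "indicator {0..1} t *\<^sub>R ?d t = 0"
        by (auto simp: indicator_def)
      show ?thesis
        unfolding zero by simp
    qed
  qed
  also have "\<dots> = (\<integral>\<^sup>+t\<in>{0<..T}. ennreal (cmod (char \<mu> t - char \<nu> t) / t) \<partial>lborel)"
    using \<open>0 < T\<close> by (rule nn_integral_Ioc_scale[symmetric]) measurable
  also have "\<dots> \<le> ennreal \<epsilon>"
    by (rule \<epsilon>)
  finally have "\<bar>LBINT t:{0..1}. ?d t\<bar> \<le> \<epsilon>"
    using \<open>0 \<le> \<epsilon>\<close> by (simp only: ennreal_le_iff)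
  then show ?thesis
    unfolding eq using fejer_mass_pos by (simp add: divide_right_mono)
qed

text \<open>If \<open>|D|\<close> is near its supremum at \<open>x\<close>, then the one-sided drift bound keeps \<open>D\<close> near this value
  on an interval of length \<open>2 h / T\<close> on one side of \<open>x\<close>, which carries at least 3/4 of the
  smoothing mass centred at its midpoint.\<close>

lemma (in real_distribution) smoothing_bound:
  fixes D :: "real \<Rightarrow> real"
  assumes [measurable]: "D \<in> borel_measurable borel"
    and D1: "\<And>x. \<bar>D x\<bar> \<le> 1"
    and drift: "\<And>x u. 0 \<le> u \<Longrightarrow> D x - u \<le> D (x + u)"
    and pos: "0 < T" "0 < h"
    and mass: "3 / 4 \<le> measure M {-h..h}"
    and smooth: "\<And>a. \<bar>\<integral>u. D (a - u / T) \<partial>M\<bar> \<le> \<epsilon>"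
  shows "\<bar>D x\<bar> \<le> 2 * \<epsilon> + 3 * h / T"
proof -
  define \<Delta> where "\<Delta> = (SUP x. \<bar>D x\<bar>)"
  have D\<Delta>: "\<bar>D x\<bar> \<le> \<Delta>" for x
    unfolding \<Delta>_def using D1 by (intro cSUP_upper bdd_aboveI2[where M = 1]) auto
  then have \<Delta>0: "0 \<le> \<Delta>"
    using abs_ge_zero[of "D 0"] by (meson order_trans)
  let ?p = "measure M {-h..h}"
  have p1: "?p \<le> 1"
    by simp
  have \<epsilon>0: "0 \<le> \<epsilon>"
    using smooth[of 0] abs_ge_zero by (rule order_trans[rotated])
  have int: "integrable M (\<lambda>u. D (a - u / T))" for a
    using D1 by (intro integrable_const_bound[where B = 1]) auto
  \<comment> \<open>Split of the average: at least \<open>c\<close> on the central interval, at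
    least \<open>- \<Delta>\<close> on the rest.\<close>
  have lower: "c * ?p - \<Delta> * (1 - ?p) \<le> (\<integral>u. \<sigma> * D (a - u / T) \<partial>M)"
    if "\<bar>\<sigma>\<bar> = 1" and c: "\<And>u. \<bar>u\<bar> \<le> h \<Longrightarrow> c \<le> \<sigma> * D (a - u / T)" for \<sigma> a c
  proof -
    have ind: "integrable M (indicator {-h..h} :: real \<Rightarrow> real)"
      by (intro integrable_const_bound[where B = 1]) (auto simp: indicator_def)
    have "c * ?p - \<Delta> * (1 - ?p) = (c + \<Delta>) * ?p - \<Delta>"
      by (simp add: algebra_simps)
    also have "\<dots> = (\<integral>u. (c + \<Delta>) * indicator {-h..h} u - \<Delta> \<partial>M)"
      using ind prob_space by (subst Bochner_Integration.integral_diff) simp_all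
    also have "\<dots> \<le> (\<integral>u. \<sigma> * D (a - u / T) \<partial>M)"
    proof (rule Bochner_Integration.integral_mono)
      show "(c + \<Delta>) * indicator {-h..h} u - \<Delta> \<le> \<sigma> * D (a - u / T)" for u
      proof (cases "u \<in> {-h..h}")
        case True
        then show ?thesis
          using c[of u] by auto
      next
        case False
        have "\<bar>\<sigma> * D (a - u / T)\<bar> \<le> \<Delta>"
          using D\<Delta> that by (simp add: abs_mult)
        then show ?thesis
          using False by auto
      qed
    qed (use int ind in auto)
    finally show ?thesis .
  qed
  have main: "3 / 4 * \<bar>D x\<bar> \<le> \<epsilon> + \<Delta> / 4 + 3 / 2 * (h / T)" for x
  proof -
    \<comment> \<open>The sign of \<open>D x\<close> decides the side: drift pushes a positive value
      to the right of \<open>x\<close> and a negative one to the left, so the centre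
      \<open>a\<close> is \<open>x + h / T\<close> or \<open>x - h / T\<close>.\<close>
    obtain a \<sigma> where \<sigma>: "\<bar>\<sigma>\<bar> = (1 :: real)"
      and a: "\<And>u. \<bar>u\<bar> \<le> h \<Longrightarrow> \<bar>D x\<bar> - 2 * (h / T) \<le> \<sigma> * D (a - u / T)"
    proof (cases "0 \<le> D x")
      case True
      have "\<bar>D x\<bar> - 2 * (h / T) \<le> 1 * D (x + h / T - u / T)" if "\<bar>u\<bar> \<le> h" for u
      proof -
        have "0 \<le> (h - u) / T" "(h - u) / T \<le> 2 * h / T"
          using that pos by (auto intro!: divide_right_mono)
        then show ?thesis
          using drift[of "(h - u) / T" x] True by (simp add: diff_divide_distrib algebra_simps)
      qed
      then show ?thesis
        using that[of 1 "x + h / T"] by simp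
    next
      case False
      have "\<bar>D x\<bar> - 2 * (h / T) \<le> -1 * D (x - h / T - u / T)" if "\<bar>u\<bar> \<le> h" for u
      proof -
        have "0 \<le> (h + u) / T" "(h + u) / T \<le> 2 * h / T"
          using that pos by (auto intro!: divide_right_mono)
        then show ?thesis
          using drift[of "(h + u) / T" "x - h / T - u / T"] False
          by (simp add: add_divide_distrib algebra_simps)
      qed
      then show ?thesis
        using that[of "-1" "x - h / T"] by simp
    qed
    have "(\<bar>D x\<bar> - 2 * (h / T)) * ?p - \<Delta> * (1 - ?p) \<le> \<bar>\<integral>u. \<sigma> * D (a - u / T) \<partial>M\<bar>"
      using lower[OF \<sigma> a] by (rule order_trans) simp_all
    also have "\<dots> \<le> \<epsilon>"
      using smooth[of a] \<sigma> by (simp add: abs_mult)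
    finally have *: "(\<bar>D x\<bar> - 2 * (h / T)) * ?p - \<Delta> * (1 - ?p) \<le> \<epsilon>" .
    have \<Delta>p: "\<Delta> * (1 - ?p) \<le> \<Delta> * (1 / 4)"
      using mass \<Delta>0 by (intro mult_left_mono) auto
    show ?thesis
    proof (cases "0 \<le> \<bar>D x\<bar> - 2 * (h / T)")
      case True
      then have "(\<bar>D x\<bar> - 2 * (h / T)) * (3 / 4) \<le> (\<bar>D x\<bar> - 2 * (h / T)) * ?p"
        using mass by (intro mult_left_mono) auto
      then show ?thesis
        using * \<Delta>p by argo
    next
      case False
      then show ?thesis
        using \<epsilon>0 \<Delta>0 by argo
    qed
  qed
  \<comment> \<open>Taking the supremum in \<open>main\<close> puts \<open>\<Delta>\<close> on both
    sides; the coefficient on the right is 1/3 after scaling, so it can be absorbed.\<close>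
  have "\<Delta> \<le> 4 / 3 * (\<epsilon> + \<Delta> / 4 + 3 / 2 * (h / T))"
    unfolding \<Delta>_def
  proof (rule cSUP_least)
    show "\<bar>D x\<bar> \<le> 4 / 3 * (\<epsilon> + (SUP x. \<bar>D x\<bar>) / 4 + 3 / 2 * (h / T))" for x
      using main[of x] unfolding \<Delta>_def by argo
  qed simp
  then have "\<Delta> \<le> 2 * \<epsilon> + 3 * (h / T)"
    using \<epsilon>0 by argo
  then show ?thesis
    using D\<Delta>[of x] by simp
qed

section \<open>Comparison with the normal distribution function\<close>

lemma std_normal_density_le_1: "std_normal_density x \<le> 1"
proof -
  have "1 \<le> sqrt (2 * pi)"
    using pi_gt3 by (intro real_le_rsqrt) auto
  moreover have "exp (- x\<^sup>2 / 2) \<le> 1"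
    by simp
  ultimately have "exp (- x\<^sup>2 / 2) \<le> sqrt (2 * pi)"
    by (rule order_trans[rotated])
  then show ?thesis
    by (simp add: std_normal_density_def divide_le_eq)
qed

lemma cdf_std_normal_diff:
  assumes "a \<le> b"
  shows "cdf std_normal_distribution b - cdf std_normal_distribution a = integral {a..b} std_normal_density"
    and "cdf std_normal_distribution b - cdf std_normal_distribution a \<le> b - a"
proof -
  interpret real_distribution std_normal_distribution
    by (rule real_dist_normal_dist)
  have cont: "continuous_on {a..b} std_normal_density"
    by (auto simp: std_normal_density_def[abs_def] intro!: continuous_intros)
  then have int: "integrable lborel (\<lambda>x. indicator {a..b} x *\<^sub>R std_normal_density x)"
    by (intro borel_integrable_compact) auto
  have "cdf std_normal_distribution b - cdf std_normal_distribution a = measure std_normal_distribution {a<..b}"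
    using assms by (cases "a = b") (auto intro: cdf_diff_eq)
  also have "emeasure std_normal_distribution {a<..b}
      = (\<integral>\<^sup>+x. ennreal (indicator {a..b} x *\<^sub>R std_normal_density x) \<partial>lborel)"
    using AE_lborel_singleton[of a]
    by (subst emeasure_density) (auto intro!: nn_integral_cong_AE simp: indicator_def)
  then have "measure std_normal_distribution {a<..b} = (LBINT x:{a..b}. std_normal_density x)"
    using int unfolding measure_def set_lebesgue_integral_def
    by (subst (asm) nn_integral_eq_integral) (auto intro!: enn2real_ennreal integral_nonneg_AE)
  also have "\<dots> = integral {a..b} std_normal_density"
    using int by (intro set_borel_integral_eq_integral) (simp add: set_integrable_def)
  finally show *: "cdf std_normal_distribution b - cdf std_normal_distribution a = integral {a..b} std_normal_density" .
  have "integral {a..b} std_normal_density \<le> integral {a..b} (\<lambda>_. 1)"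
    using cont std_normal_density_le_1 by (intro integral_le integrable_continuous_real) auto
  then show "cdf std_normal_distribution b - cdf std_normal_distribution a \<le> b - a"
    using * assms by simp
qed

text \<open>The difference of the distribution functions satisfies the drift condition of
  \<open>smoothing_bound\<close>, since \<open>cdf \<mu>\<close> is nondecreasing and the normal one
  is 1-Lipschitz. The constant depends only on the kernel and is obtained before
  \<open>\<mu>\<close> and \<open>T\<close>.\<close>

lemma Esseen_smoothing:
  obtains C where "C > 0"
    "\<And>\<mu> T \<epsilon> x. \<lbrakk>real_distribution \<mu>; integrable \<mu> (\<lambda>x. x); 0 < T; 0 \<le> \<epsilon>;
      (\<integral>\<^sup>+t\<in>{0<..T}. ennreal (cmod (char \<mu> t - char std_normal_distribution t) / t) \<partial>lborel) \<le> ennreal \<epsilon>\<rbrakk>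
      \<Longrightarrow> \<bar>cdf \<mu> x - cdf std_normal_distribution x\<bar> \<le> C * (\<epsilon> + 1 / T)"
proof -
  interpret K: real_distribution fejer_distribution
    by (rule real_distribution_fejer)
  interpret N: real_distribution std_normal_distribution
    by (rule real_dist_normal_dist)
  have "\<forall>\<^sub>F h in at_top. 7 / 8 < cdf fejer_distribution h"
    using K.cdf_lim_at_top_prob by (rule order_tendstoD) simp
  moreover have "\<forall>\<^sub>F h in at_top. cdf fejer_distribution (- h) < 1 / 8"
    using K.cdf_lim_at_bot unfolding filterlim_at_bot_mirror by (rule order_tendstoD) simp
  moreover have "\<forall>\<^sub>F h in at_top. (0::real) < h"
    by (rule eventually_gt_at_top)
  ultimately have "\<forall>\<^sub>F h in at_top. 7 / 8 < cdf fejer_distribution h \<and> cdf fejer_distribution (- h) < 1 / 8 \<and> 0 < h"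
    by eventually_elim simp
  then obtain h where h: "7 / 8 < cdf fejer_distribution h" "cdf fejer_distribution (- h) < 1 / 8" "0 < h"
    by (auto dest: eventually_happens)
  have "3 / 4 \<le> measure fejer_distribution {- h<..h}"
    using h K.cdf_diff_eq[of "- h" h] by simp
  also have "\<dots> \<le> measure fejer_distribution {- h..h}"
    by (intro K.finite_measure_mono) auto
  finally have mass: "3 / 4 \<le> measure fejer_distribution {- h..h}" .
  define C where "C = max (2 / fejer_mass) (3 * h)"
  show ?thesis
  proof (rule that[of C])
    show "0 < C"
      using h by (simp add: C_def)
  next
    fix \<mu> T \<epsilon> x
    assume \<mu>: "real_distribution \<mu>" "integrable \<mu> (\<lambda>x. x)" and T: "0 < T" and \<epsilon>: "0 \<le> \<epsilon>"
      "(\<integral>\<^sup>+t\<in>{0<..T}. ennreal (cmod (char \<mu> t - char std_normal_distribution t) / t) \<partial>lborel) \<le> ennreal \<epsilon>"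
    interpret R: real_distribution \<mu>
      by (rule \<mu>)
    let ?D = "\<lambda>x. cdf \<mu> x - cdf std_normal_distribution x"
    have [measurable]: "cdf \<mu> \<in> borel_measurable borel" "cdf std_normal_distribution \<in> borel_measurable borel"
      by (auto intro!: borel_measurable_mono monoI R.cdf_nondecreasing N.cdf_nondecreasing)
    have "\<bar>?D x\<bar> \<le> 2 * (\<epsilon> / fejer_mass) + 3 * h / T"
    proof (rule K.smoothing_bound[where D = ?D, OF _ _ _ T h(3) mass])
      show "\<bar>?D x\<bar> \<le> 1" for x
        using R.cdf_nonneg[of x] R.cdf_bounded_prob[of x] N.cdf_nonneg[of x] N.cdf_bounded_prob[of x]
        by linarith
      show "?D x - u \<le> ?D (x + u)" if "0 \<le> u" for x u
        using that R.cdf_nondecreasing[of x "x + u"] cdf_std_normal_diff(2)[of x "x + u"] by linarith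
      show "\<bar>\<integral>u. ?D (a - u / T) \<partial>fejer_distribution\<bar> \<le> \<epsilon> / fejer_mass" for a
        using integrable_std_normal_distribution_moment[of 1]
        by (intro fejer_smoothed_difference \<mu> N.real_distribution_axioms T \<epsilon> real_dist_normal_dist) simp
    qed measurable
    also have "2 * (\<epsilon> / fejer_mass) + 3 * h / T = 2 / fejer_mass * \<epsilon> + 3 * h * (1 / T)"
      by simp
    also have "\<dots> \<le> C * \<epsilon> + C * (1 / T)"
      using \<epsilon> T by (intro add_mono mult_right_mono) (auto simp: C_def)
    finally show "\<bar>?D x\<bar> \<le> C * (\<epsilon> + 1 / T)"
      by (simp add: distrib_left)
  qed
qed

text \<open>Each endpoint contributes one \<open>e\<close>. The closed interval contains its left
  endpoint, so the left limit of the distribution function occurs there; the bound survives this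
  limit because the normal distribution has no atoms.\<close>

lemma normal_discrepancy_le:
  assumes "prob_space M" and [measurable]: "S \<in> borel_measurable M"
    and close: "\<And>x. \<bar>cdf (distr M borel S) x - cdf std_normal_distribution x\<bar> \<le> e"
  shows "normal_discrepancy M S \<le> 2 * e"
proof -
  interpret M: prob_space M by fact
  interpret R: real_distribution "distr M borel S"
    by simp
  interpret N: real_distribution std_normal_distribution
    by (rule real_dist_normal_dist)
  have left: "\<bar>measure (distr M borel S) {..<a} - cdf std_normal_distribution a\<bar> \<le> e" for a
  proof -
    have "emeasure std_normal_distribution {a} = 0"
      by (subst emeasure_density) (auto intro!: nn_integral_0_iff_AE[THEN iffD2] AE_lborel_singleton)
    then have "isCont (cdf std_normal_distribution) a"
      by (simp add: N.isCont_cdf measure_def)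
    then have "(cdf std_normal_distribution \<longlongrightarrow> cdf std_normal_distribution a) (at_left a)"
      unfolding isCont_def by (rule filterlim_at_split[THEN iffD1, THEN conjunct1])
    then have "((\<lambda>x. \<bar>cdf (distr M borel S) x - cdf std_normal_distribution x\<bar>)
        \<longlongrightarrow> \<bar>measure (distr M borel S) {..<a} - cdf std_normal_distribution a\<bar>) (at_left a)"
      by (intro tendsto_intros R.cdf_at_left)
    then show ?thesis
      by (rule tendsto_upperbound) (auto simp: close)
  qed
  show ?thesis
    unfolding normal_discrepancy_def
  proof (rule cSUP_least)
    show "{(\<alpha>, \<beta>). \<alpha> < (\<beta>::real)} \<noteq> {}"
      using zero_less_one by blast
  next
    fix p :: "real \<times> real" assume "p \<in> {(\<alpha>, \<beta>). \<alpha> < \<beta>}"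
    then obtain \<alpha> \<beta> where p: "p = (\<alpha>, \<beta>)" "\<alpha> < \<beta>" by auto
    have "\<P>(\<omega> in M. \<alpha> \<le> S \<omega> \<and> S \<omega> \<le> \<beta>) = measure (distr M borel S) {\<alpha>..\<beta>}"
      by (subst measure_distr) (auto intro!: arg_cong[where f = "measure M"])
    also have "{\<alpha>..\<beta>} = {..\<beta>} - {..<\<alpha>}"
      by auto
    also have "measure (distr M borel S) \<dots> = cdf (distr M borel S) \<beta> - measure (distr M borel S) {..<\<alpha>}"
      unfolding cdf_def using p by (intro R.finite_measure_Diff) auto
    finally have 1: "\<P>(\<omega> in M. \<alpha> \<le> S \<omega> \<and> S \<omega> \<le> \<beta>)
        = cdf (distr M borel S) \<beta> - measure (distr M borel S) {..<\<alpha>}" .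
    have 2: "1 / sqrt (2 * pi) * integral {\<alpha>..\<beta>} (\<lambda>t. exp (- (t ^ 2) / 2))
        = cdf std_normal_distribution \<beta> - cdf std_normal_distribution \<alpha>"
      using p by (subst cdf_std_normal_diff) (simp_all add: std_normal_density_def[abs_def])
    show "(case p of (\<alpha>, \<beta>) \<Rightarrow> \<bar>\<P>(\<omega> in M. \<alpha> \<le> S \<omega> \<and> S \<omega> \<le> \<beta>)
          - 1 / sqrt (2 * pi) * integral {\<alpha>..\<beta>} (\<lambda>t. exp (- (t ^ 2) / 2))\<bar>) \<le> 2 * e"
      unfolding p(1) case_prod_conv 1 2 using close[of \<beta>] left[of \<alpha>] by linarith
  qed
qed

section \<open>The characteristic function of a block\<close>

lemma nn_integral_inverse_cube:
  fixes a :: real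
  assumes "0 < a"
  shows "(\<integral>\<^sup>+t\<in>{a..}. ennreal (1 / t ^ 3) \<partial>lborel) = ennreal (1 / (2 * a\<^sup>2))"
proof -
  have "(\<integral>\<^sup>+t\<in>{a..}. ennreal (1 / t ^ 3) \<partial>lborel) = ennreal (0 - (- 1 / (2 * a\<^sup>2)))"
  proof (rule nn_integral_FTC_atLeast)
    show "((\<lambda>t. - 1 / (2 * t\<^sup>2)) has_real_derivative 1 / t ^ 3) (at t)" if "a \<le> t" for t
      using that assms by (auto intro!: derivative_eq_intros simp: eval_nat_numeral field_simps)
    show "((\<lambda>t::real. - 1 / (2 * t\<^sup>2)) \<longlongrightarrow> 0) at_top"
      by real_asymp
  qed (use assms in auto)
  then show ?thesis by simp
qed

lemma nn_integral_cube_gaussian: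
  fixes c :: real
  assumes "0 < c"
  shows "(\<integral>\<^sup>+t\<in>{0..}. ennreal (t ^ 3 * exp (- c * t\<^sup>2)) \<partial>lborel) = ennreal (1 / (2 * c\<^sup>2))"
proof -
  let ?F = "\<lambda>t. - (t\<^sup>2 / (2 * c) + 1 / (2 * c\<^sup>2)) * exp (- c * t\<^sup>2)"
  have "(\<integral>\<^sup>+t\<in>{0..}. ennreal (t ^ 3 * exp (- c * t\<^sup>2)) \<partial>lborel) = ennreal (0 - ?F 0)"
  proof (rule nn_integral_FTC_atLeast)
    show "(?F has_real_derivative t ^ 3 * exp (- c * t\<^sup>2)) (at t)" if "0 \<le> t" for t
      using assms by (auto intro!: derivative_eq_intros simp: eval_nat_numeral field_simps)
    show "(?F \<longlongrightarrow> 0) at_top"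
      using assms by real_asymp
  qed auto
  then show ?thesis by simp
qed

lemma exp_minus_le_inverse: "exp (- x) \<le> 1 / x" if "0 < x" for x :: real
proof -
  have "x \<le> exp x"
    using exp_ge_add_one_self[of x] by linarith
  then show ?thesis
    using that by (simp add: exp_minus field_simps)
qed

text \<open>Replacing \<open>exp (- x)\<close> by \<open>1 / x\<close> leaves an inverse cube. With
  \<open>c\<close> of order \<open>m\<close> and \<open>a\<close> of order \<open>1 / q\<close> the
  result has the target order \<open>q^2 / m\<close>.\<close>

lemma nn_integral_gaussian_tail:
  assumes "0 < c" "0 < a"
  shows "(\<integral>\<^sup>+t\<in>{a..}. ennreal (exp (- (c * t\<^sup>2)) / t) \<partial>lborel) \<le> ennreal (1 / (2 * c * a\<^sup>2))"
proof -
  have "(\<integral>\<^sup>+t\<in>{a..}. ennreal (exp (- (c * t\<^sup>2)) / t) \<partial>lborel)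
      \<le> (\<integral>\<^sup>+t. ennreal (1 / c) * (ennreal (1 / t ^ 3) * indicator {a..} t) \<partial>lborel)"
  proof (intro nn_integral_mono)
    fix t
    show "ennreal (exp (- (c * t\<^sup>2)) / t) * indicator {a..} t
        \<le> ennreal (1 / c) * (ennreal (1 / t ^ 3) * indicator {a..} t)"
    proof (cases "a \<le> t")
      case True
      then have "exp (- (c * t\<^sup>2)) / t \<le> 1 / (c * t\<^sup>2) / t"
        using assms by (intro divide_right_mono exp_minus_le_inverse) auto
      also have "\<dots> = 1 / c * (1 / t ^ 3)"
        by (simp add: eval_nat_numeral)
      finally show ?thesis
        using True assms by (simp add: ennreal_leI flip: ennreal_mult')
    qed simp
  qed
  also have "\<dots> = ennreal (1 / c) * (\<integral>\<^sup>+t\<in>{a..}. ennreal (1 / t ^ 3) \<partial>lborel)"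
    by (rule nn_integral_cmult) measurable
  also have "\<dots> = ennreal (1 / (2 * c * a\<^sup>2))"
    using assms by (subst nn_integral_inverse_cube) (auto simp: mult_ac simp flip: ennreal_mult')
  finally show ?thesis .
qed

text \<open>Factorization of \<open>a^m - b^m\<close>. All but one of the factors \<open>r\<close>
  are kept, so the decay of the powers survives.\<close>

lemma power_diff_le:
  fixes a b r :: real and m :: nat
  assumes "\<bar>a\<bar> \<le> r" "\<bar>b\<bar> \<le> r"
  shows "\<bar>a ^ m - b ^ m\<bar> \<le> m * r ^ (m - 1) * \<bar>a - b\<bar>"
proof -
  have eq: "\<bar>a ^ m - b ^ m\<bar> = \<bar>a - b\<bar> * \<bar>\<Sum>i<m. a ^ i * b ^ (m - Suc i)\<bar>"
    unfolding power_diff_sumr2 abs_mult by (simp only: mult.commute[of "b ^ _"])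
  have "\<bar>\<Sum>i<m. a ^ i * b ^ (m - Suc i)\<bar> \<le> (\<Sum>i<m. r ^ (m - 1))"
  proof (rule order_trans[OF sum_abs sum_mono])
    fix i assume i: "i \<in> {..<m}"
    have "\<bar>a ^ i * b ^ (m - Suc i)\<bar> \<le> r ^ i * r ^ (m - Suc i)"
      using assms unfolding abs_mult power_abs by (intro mult_mono power_mono) auto
    also have "\<dots> = r ^ (m - 1)"
      using i by (simp flip: power_add)
    finally show "\<bar>a ^ i * b ^ (m - Suc i)\<bar> \<le> r ^ (m - 1)" .
  qed
  then have "\<bar>a - b\<bar> * \<bar>\<Sum>i<m. a ^ i * b ^ (m - Suc i)\<bar> \<le> \<bar>a - b\<bar> * (\<Sum>i<m. r ^ (m - 1))"
    by (rule mult_left_mono) simp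
  then show ?thesis
    unfolding eq by (simp add: mult_ac)
qed

text \<open>Here \<open>\<nu>\<close> is the law of \<open>X - X'\<close>, \<open>q = \<delta>\<^sup>2\<close>, and \<open>h s\<close> below is \<open>|f s|\<^sup>2\<close>.\<close>

locale symmetrized_law = real_distribution \<nu> for \<nu> :: "real measure" +
  fixes q :: real
  assumes q_ge_1: "1 \<le> q"
    and integrable_4: "integrable \<nu> (\<lambda>y. y ^ 4)"
    and second_moment: "(\<integral>y. y\<^sup>2 \<partial>\<nu>) = 2"
    and fourth_moment: "(\<integral>y. y ^ 4 \<partial>\<nu>) \<le> 16 * q\<^sup>2"
    and char_nonneg: "0 \<le> (\<integral>y. cos (s * y) \<partial>\<nu>)"
begin

definition h :: "real \<Rightarrow> real" where
  "h s = (\<integral>y. cos (s * y) \<partial>\<nu>)"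

section \<open>Taylor bounds for the squared modulus of the characteristic function\<close>

lemma integrable_2: "integrable \<nu> (\<lambda>y. y\<^sup>2)"
proof (rule Bochner_Integration.integrable_bound)
  show "integrable \<nu> (\<lambda>y. 1 + y ^ 4)"
    using integrable_4 by simp
  show "AE y in \<nu>. norm (y\<^sup>2) \<le> norm (1 + y ^ 4)"
  proof (intro AE_I2)
    fix y :: real
    have "0 \<le> (y\<^sup>2 - 1)\<^sup>2"
      by simp
    then have "2 * y\<^sup>2 \<le> 1 + y ^ 4"
      by (simp add: power2_diff flip: power_mult)
    then have "y\<^sup>2 \<le> 1 + y ^ 4"
      using zero_le_power2[of y] by linarith
    then show "norm (y\<^sup>2) \<le> norm (1 + y ^ 4)"
      by simp
  qed
qed simp

lemma integrable_cos: "integrable \<nu> (\<lambda>y. cos (s * y))"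
  by (intro integrable_const_bound[where B = 1]) auto

lemma h_nonneg: "0 \<le> h s"
  unfolding h_def by (rule char_nonneg)

lemma h_le_1: "h s \<le> 1"
proof -
  have "h s \<le> (\<integral>y. 1 \<partial>\<nu>)"
    unfolding h_def by (intro Bochner_Integration.integral_mono integrable_cos) auto
  then show ?thesis
    using prob_space by simp
qed

text \<open>The cosine has no cubic term, so no third moment appears. The constant is
  \<open>16 / 24\<close>, from the fourth moment bound and the Taylor remainder.\<close>

lemma h_approx: "\<bar>h s - (1 - s\<^sup>2)\<bar> \<le> 2 / 3 * q\<^sup>2 * s ^ 4"
proof -
  have "h s - (1 - s\<^sup>2) = (\<integral>y. cos (s * y) - (1 - (s * y)\<^sup>2 / 2) \<partial>\<nu>)"
    using integrable_2 integrable_cos second_moment prob_space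
    by (simp add: h_def power_mult_distrib)
  also have "\<bar>\<dots>\<bar> \<le> (\<integral>y. \<bar>cos (s * y) - (1 - (s * y)\<^sup>2 / 2)\<bar> \<partial>\<nu>)"
    by (rule integral_abs_bound)
  also have "\<dots> \<le> (\<integral>y. s ^ 4 / 24 * y ^ 4 \<partial>\<nu>)"
  proof (rule Bochner_Integration.integral_mono)
    show "integrable \<nu> (\<lambda>y. \<bar>cos (s * y) - (1 - (s * y)\<^sup>2 / 2)\<bar>)"
      using integrable_2 integrable_cos by (simp add: power_mult_distrib)
    show "\<bar>cos (s * y) - (1 - (s * y)\<^sup>2 / 2)\<bar> \<le> s ^ 4 / 24 * y ^ 4" for y
      using cos_approx4[of "s * y"] by (simp add: power_mult_distrib)
  qed (use integrable_4 in simp)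
  also have "\<dots> = s ^ 4 / 24 * (\<integral>y. y ^ 4 \<partial>\<nu>)"
    by simp
  also have "\<dots> \<le> s ^ 4 / 24 * (16 * q\<^sup>2)"
    using fourth_moment by (intro mult_left_mono) auto
  finally show ?thesis
    by simp
qed

lemma h_gaussian_approx: "\<bar>h s - exp (- s\<^sup>2)\<bar> \<le> 2 * q\<^sup>2 * s ^ 4"
proof -
  have "\<bar>exp (- s\<^sup>2) - (1 - s\<^sup>2)\<bar> \<le> s ^ 4 / 2"
  proof -
    have "1 - s\<^sup>2 \<le> exp (- s\<^sup>2)"
      using exp_ge_add_one_self[of "- s\<^sup>2"] by simp
    moreover have "exp (- s\<^sup>2) \<le> 1 - s\<^sup>2 + (s\<^sup>2)\<^sup>2 / 2"
    proof -
      define x where "x = s\<^sup>2"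
      have x: "0 \<le> x" by (simp add: x_def)
      have "((\<lambda>x. 1 - x + x\<^sup>2 / 2 - exp (- x)) has_real_derivative - 1 + x + exp (- x)) (at x)" for x :: real
        by (auto intro!: derivative_eq_intros)
      moreover have "0 \<le> - 1 + x + exp (- x)" for x :: real
        using exp_ge_add_one_self[of "- x"] by linarith
      ultimately have "(1 - 0 + 0\<^sup>2 / 2 - exp (- 0)) \<le> 1 - x + x\<^sup>2 / 2 - exp (- x)"
        by (intro DERIV_nonneg_imp_nondecreasing[OF x]) blast
      then show ?thesis
        by (simp add: x_def)
    qed
    ultimately show ?thesis
      by (simp flip: power_mult)
  qed
  moreover have "1 * s ^ 4 \<le> q\<^sup>2 * s ^ 4"
    using q_ge_1 by (intro mult_right_mono) (auto simp: one_le_power)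
  ultimately show ?thesis
    using h_approx[of s] by linarith
qed

text \<open>The hypothesis makes the remainder in \<open>h_approx\<close> at most
  \<open>s^2 / 2\<close>, half of the quadratic term.\<close>

lemma h_le_exp:
  assumes "s\<^sup>2 * q\<^sup>2 \<le> 3 / 4"
  shows "h s \<le> exp (- (s\<^sup>2 / 2))"
proof -
  have "2 / 3 * q\<^sup>2 * s ^ 4 = 2 / 3 * (s\<^sup>2 * q\<^sup>2) * s\<^sup>2"
    by (simp add: eval_nat_numeral)
  also have "\<dots> \<le> 2 / 3 * (3 / 4) * s\<^sup>2"
    using assms by (intro mult_right_mono mult_left_mono) auto
  finally have "h s \<le> 1 + - (s\<^sup>2 / 2)"
    using h_approx[of s] by linarith
  also have "\<dots> \<le> exp (- (s\<^sup>2 / 2))"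
    by (rule exp_ge_add_one_self)
  finally show ?thesis .
qed

lemma block_approx: "\<bar>h s * h (sqrt 2 * s) - exp (- (3 * s\<^sup>2))\<bar> \<le> 10 * q\<^sup>2 * s ^ 4"
proof -
  let ?a = "h s" and ?b = "h (sqrt 2 * s)" and ?c = "exp (- s\<^sup>2)" and ?d = "exp (- (sqrt 2 * s)\<^sup>2)"
  have s4: "(sqrt 2 * s) ^ 4 = 4 * s ^ 4"
    by (simp add: power_mult_distrib eval_nat_numeral)
  have "?a * ?b - ?c * ?d = (?a - ?c) * ?b + ?c * (?b - ?d)"
    by (simp add: algebra_simps)
  then have "\<bar>?a * ?b - ?c * ?d\<bar> \<le> \<bar>?a - ?c\<bar> * \<bar>?b\<bar> + \<bar>?c\<bar> * \<bar>?b - ?d\<bar>"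
    by (metis abs_mult abs_triangle_ineq)
  also have "\<dots> \<le> \<bar>?a - ?c\<bar> * 1 + 1 * \<bar>?b - ?d\<bar>"
    using h_nonneg h_le_1 by (intro add_mono mult_mono) auto
  also have "\<dots> \<le> 2 * q\<^sup>2 * s ^ 4 + 8 * q\<^sup>2 * s ^ 4"
    using h_gaussian_approx[of s] h_gaussian_approx[of "sqrt 2 * s"] unfolding s4 by simp
  also have "?c * ?d = exp (- (3 * s\<^sup>2))"
    by (simp add: power_mult_distrib flip: exp_add)
  finally show ?thesis
    by simp
qed

text \<open>In this range both the block and its Gaussian counterpart are at most
  \<open>exp (- (3 / 2 * s^2))\<close>; \<open>power_diff_le\<close> then reduces the claim to
  \<open>block_approx\<close> for a single block.\<close>

lemma small_frequency:
  fixes m :: nat and s :: real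
  assumes "0 < m" "0 < s" "s * q \<le> 1 / 2"
  shows "\<bar>(h s * h (sqrt 2 * s)) ^ m - exp (- (3 * real m * s\<^sup>2))\<bar> \<le> 30 * m * q\<^sup>2 * s ^ 4 * exp (- (m * s\<^sup>2))"
proof -
  let ?B = "h s * h (sqrt 2 * s)" and ?r = "exp (- (3 / 2 * s\<^sup>2))"
  have "(s * q)\<^sup>2 \<le> (1 / 2)\<^sup>2"
    using assms q_ge_1 by (intro power_mono) auto
  then have sq: "s\<^sup>2 * q\<^sup>2 \<le> 1 / 4"
    by (simp add: power_mult_distrib power_divide)
  have "s\<^sup>2 * 1 \<le> s\<^sup>2 * q\<^sup>2"
    using q_ge_1 by (intro mult_left_mono) (auto simp: one_le_power)
  then have s1: "s\<^sup>2 \<le> 1 / 4"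
    using sq by simp
  have "?B \<le> exp (- (s\<^sup>2 / 2)) * exp (- ((sqrt 2 * s)\<^sup>2 / 2))"
    using sq h_nonneg by (intro mult_mono h_le_exp) (auto simp: power_mult_distrib)
  also have "\<dots> = ?r"
    by (simp add: power_mult_distrib flip: exp_add)
  finally have "\<bar>?B\<bar> \<le> ?r"
    using h_nonneg by simp
  moreover have "\<bar>exp (- (3 * s\<^sup>2))\<bar> \<le> ?r"
    by simp
  ultimately have "\<bar>?B ^ m - exp (- (3 * s\<^sup>2)) ^ m\<bar> \<le> m * ?r ^ (m - 1) * \<bar>?B - exp (- (3 * s\<^sup>2))\<bar>"
    by (rule power_diff_le)
  also have "\<dots> \<le> m * (3 * exp (- (m * s\<^sup>2))) * (10 * q\<^sup>2 * s ^ 4)"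
  proof (intro mult_mono mult_left_mono block_approx)
    \<comment> \<open>The power lost in \<open>m - 1\<close> costs \<open>3 / 2 * s^2\<close>, which
      is below 1 since \<open>s^2 \<le> 1 / 4\<close>; this gives the factor \<open>exp 1\<close>,
      at most 3.\<close>
    have "?r ^ (m - 1) = exp (- (3 / 2 * (real m - 1) * s\<^sup>2))"
      using assms by (simp add: of_nat_diff flip: exp_of_nat_mult)
    also have "\<dots> \<le> exp (1 + - (m * s\<^sup>2))"
    proof -
      have "0 \<le> real m * s\<^sup>2"
        by simp
      moreover have "3 / 2 * (real m - 1) * s\<^sup>2 = 3 / 2 * (m * s\<^sup>2) - 3 / 2 * s\<^sup>2"
        by (simp add: left_diff_distrib right_diff_distrib diff_divide_distrib)
      ultimately have "- (3 / 2 * (real m - 1) * s\<^sup>2) \<le> 1 + - (m * s\<^sup>2)"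
        using s1 by linarith
      then show ?thesis
        by (simp only: exp_le_cancel_iff)
    qed
    also have "\<dots> \<le> 3 * exp (- (m * s\<^sup>2))"
      unfolding exp_add using exp_le by (intro mult_right_mono) auto
    finally show "?r ^ (m - 1) \<le> 3 * exp (- (m * s\<^sup>2))" .
  qed auto
  also have "exp (- (3 * s\<^sup>2)) ^ m = exp (- (3 * real m * s\<^sup>2))"
    by (simp add: mult_ac flip: exp_of_nat_mult)
  finally show ?thesis
    by (simp add: mult_ac)
qed

lemma h_measurable [measurable]: "h \<in> borel_measurable borel"
proof -
  have "(\<lambda>s. \<integral>y. cos (s * y) \<partial>\<nu>) \<in> borel_measurable borel"
    by (rule borel_measurable_lebesgue_integral) (simp add: case_prod_unfold)
  then show ?thesis
    unfolding h_def[abs_def] .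
qed

text \<open>Division by \<open>s\<close> turns \<open>s^4\<close> into \<open>s^3\<close>, whose
  Gaussian integral is \<open>1 / (2 * m^2)\<close>.\<close>

lemma nn_integral_small_frequency:
  fixes m :: nat
  assumes "0 < m"
  shows "(\<integral>\<^sup>+s\<in>{0<..1 / (2 * q)}. ennreal (\<bar>(h s * h (sqrt 2 * s)) ^ m - exp (- (3 * real m * s\<^sup>2))\<bar> / s) \<partial>lborel)
    \<le> ennreal (15 * q\<^sup>2 / m)"
proof -
  have "(\<integral>\<^sup>+s\<in>{0<..1 / (2 * q)}. ennreal (\<bar>(h s * h (sqrt 2 * s)) ^ m - exp (- (3 * real m * s\<^sup>2))\<bar> / s) \<partial>lborel)
      \<le> (\<integral>\<^sup>+s. ennreal (30 * m * q\<^sup>2) * (ennreal (s ^ 3 * exp (- real m * s\<^sup>2)) * indicator {0..} s) \<partial>lborel)"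
  proof (intro nn_integral_mono)
    fix s :: real
    show "ennreal (\<bar>(h s * h (sqrt 2 * s)) ^ m - exp (- (3 * real m * s\<^sup>2))\<bar> / s) * indicator {0<..1 / (2 * q)} s
        \<le> ennreal (30 * m * q\<^sup>2) * (ennreal (s ^ 3 * exp (- real m * s\<^sup>2)) * indicator {0..} s)"
    proof (cases "s \<in> {0<..1 / (2 * q)}")
      case True
      then have "\<bar>(h s * h (sqrt 2 * s)) ^ m - exp (- (3 * real m * s\<^sup>2))\<bar> / s
          \<le> 30 * m * q\<^sup>2 * s ^ 4 * exp (- (m * s\<^sup>2)) / s"
        using assms q_ge_1 by (intro divide_right_mono small_frequency) (auto simp: field_simps)
      also have "\<dots> = 30 * m * q\<^sup>2 * (s ^ 3 * exp (- real m * s\<^sup>2))"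
        using True by (simp add: eval_nat_numeral)
      finally show ?thesis
        using True by (simp add: ennreal_leI flip: ennreal_mult')
    qed simp
  qed
  also have "\<dots> = ennreal (30 * m * q\<^sup>2) * (\<integral>\<^sup>+s\<in>{0..}. ennreal (s ^ 3 * exp (- real m * s\<^sup>2)) \<partial>lborel)"
    by (rule nn_integral_cmult) measurable
  also have "\<dots> = ennreal (30 * m * q\<^sup>2) * ennreal (1 / (2 * (real m)\<^sup>2))"
    using assms by (subst nn_integral_cube_gaussian) auto
  also have "\<dots> = ennreal (15 * q\<^sup>2 / m)"
    using assms by (simp add: power2_eq_square mult_ac flip: ennreal_mult')
  finally show ?thesis .
qed

text \<open>The factor \<open>y^2\<close> cancels the denominator in the exponent
  \<open>m / y^2\<close>. The truncation bounds the rescaled frequency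
  \<open>s * \<bar>y\<bar>\<close>, at a level high enough to keep mass at least 1.\<close>

definition weight :: "real \<Rightarrow> real" where
  "weight y = y\<^sup>2 * indicator {- (4 * q)..4 * q} y"

lemma weight_nonneg: "0 \<le> weight y"
  by (simp add: weight_def)

lemma weight_measurable [measurable]: "weight \<in> borel_measurable borel"
  unfolding weight_def[abs_def] by measurable

lemma weight_le: "weight y \<le> y\<^sup>2"
  by (simp add: weight_def indicator_def)

lemma integrable_weight: "integrable \<nu> weight"
  using integrable_2
  by (rule Bochner_Integration.integrable_bound) (use weight_nonneg weight_le in auto)

text \<open>Chebyshev-type truncation: beyond \<open>4 * q\<close> one has
  \<open>y^2 \<le> y^4 / (16 * q^2)\<close>, so at most 1 of the second moment 2 is lost.\<close>

lemma integral_weight_ge_1: "1 \<le> (\<integral>y. weight y \<partial>\<nu>)"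
proof -
  have "(\<integral>y. y\<^sup>2 - y ^ 4 / (16 * q\<^sup>2) \<partial>\<nu>) \<le> (\<integral>y. weight y \<partial>\<nu>)"
  proof (rule Bochner_Integration.integral_mono)
    show "y\<^sup>2 - y ^ 4 / (16 * q\<^sup>2) \<le> weight y" for y
    proof (cases "\<bar>y\<bar> \<le> 4 * q")
      case True
      then have "weight y = y\<^sup>2"
        by (simp add: weight_def abs_le_iff)
      then show ?thesis
        by simp
    next
      case False
      then have "(4 * q)\<^sup>2 \<le> y\<^sup>2"
        using q_ge_1 by (subst abs_le_square_iff[symmetric]) auto
      then have "(16 * q\<^sup>2) * y\<^sup>2 \<le> y\<^sup>2 * y\<^sup>2"
        by (intro mult_right_mono) (auto simp: power_mult_distrib)
      then have "y\<^sup>2 \<le> y ^ 4 / (16 * q\<^sup>2)"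
        using q_ge_1 by (simp add: pos_le_divide_eq mult_ac eval_nat_numeral)
      then show ?thesis
        using weight_nonneg[of y] by linarith
    qed
  qed (use integrable_2 integrable_4 integrable_weight in auto)
  moreover have "(\<integral>y. y\<^sup>2 - y ^ 4 / (16 * q\<^sup>2) \<partial>\<nu>) = 2 - (\<integral>y. y ^ 4 \<partial>\<nu>) / (16 * q\<^sup>2)"
    using integrable_2 integrable_4 second_moment by simp
  moreover have "(\<integral>y. y ^ 4 \<partial>\<nu>) / (16 * q\<^sup>2) \<le> 1"
    using fourth_moment q_ge_1 by (simp add: divide_le_eq)
  ultimately show ?thesis
    by linarith
qed

lemma integral_weight_le_2: "(\<integral>y. weight y \<partial>\<nu>) \<le> 2"
  unfolding second_moment[symmetric]
  by (intro Bochner_Integration.integral_mono integrable_weight integrable_2 weight_le)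

text \<open>Jensen's inequality for the measure \<open>weight y \<partial>\<nu>\<close>, whose total mass is at least 1.\<close>

lemma block_power_le:
  fixes m :: nat
  shows "ennreal ((h s * h (sqrt 2 * s)) ^ m) \<le> (\<integral>\<^sup>+y. ennreal (weight y * exp (- (m / y\<^sup>2) * osc (s * y))) \<partial>\<nu>)"
proof -
  \<comment> \<open>Chosen so that \<open>weight y * b y\<close> is at most
    \<open>m * osc (s * y)\<close>; at \<open>y = 0\<close> the weight vanishes.\<close>
  define b where "b y = m / y\<^sup>2 * osc (s * y)" for y
  define X where "X = (\<integral>y. weight y * b y \<partial>\<nu>)"
  have b_nonneg: "0 \<le> b y" for y
    using osc_nonneg by (simp add: b_def)
  have [measurable]: "b \<in> borel_measurable borel"
    unfolding b_def[abs_def] by measurable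
  have wb: "weight y * b y \<le> m * osc (s * y)" for y
    using osc_nonneg[of "s * y"] by (cases "y = 0") (simp_all add: weight_def b_def indicator_def)
  have int_osc: "integrable \<nu> (\<lambda>y. osc (s * y))"
    using osc_nonneg osc_le by (intro integrable_const_bound[where B = 4]) auto
  then have int_wb: "integrable \<nu> (\<lambda>y. weight y * b y)"
    by (intro Bochner_Integration.integrable_bound[OF integrable_mult_right[of "real m", OF int_osc]])
      (use wb weight_nonneg b_nonneg osc_nonneg in auto)
  have int_we: "integrable \<nu> (\<lambda>y. weight y * exp (- b y))"
    using weight_nonneg b_nonneg
    by (intro Bochner_Integration.integrable_bound[OF integrable_weight]) (auto simp: abs_mult intro!: mult_left_le)
  have h_exp: "h t \<le> exp (- (1 - h t))" for t
    using exp_ge_add_one_self[of "- (1 - h t)"] by simp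
  have osc_int: "(\<integral>y. osc (s * y) \<partial>\<nu>) = (1 - h s) + (1 - h (sqrt 2 * s))"
    unfolding osc_def h_def using prob_space integrable_cos[of s] integrable_cos[of "sqrt 2 * s"]
    by (simp add: mult.assoc)
  have "h s * h (sqrt 2 * s) \<le> exp (- (1 - h s)) * exp (- (1 - h (sqrt 2 * s)))"
    using h_nonneg by (intro mult_mono h_exp) auto
  also have "\<dots> = exp (- (\<integral>y. osc (s * y) \<partial>\<nu>))"
    unfolding osc_int by (simp flip: exp_add)
  finally have "(h s * h (sqrt 2 * s)) ^ m \<le> exp (- (\<integral>y. osc (s * y) \<partial>\<nu>)) ^ m"
    using h_nonneg by (intro power_mono) auto
  also have "\<dots> = exp (- (\<integral>y. m * osc (s * y) \<partial>\<nu>))"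
    by (simp flip: exp_of_nat_mult)
  also have "\<dots> \<le> exp (- X)"
  proof -
    have "X \<le> (\<integral>y. m * osc (s * y) \<partial>\<nu>)"
      unfolding X_def by (rule Bochner_Integration.integral_mono[OF int_wb integrable_mult_right[OF int_osc] wb])
    then show ?thesis
      by (simp only: exp_le_cancel_iff neg_le_iff_le)
  qed
  \<comment> \<open>The total mass \<open>W\<close> of the weight is at least 1 and \<open>X\<close>
    is nonnegative, so \<open>W * (1 + X) - X\<close> is at least 1.\<close>
  also have "\<dots> \<le> exp (- X) * ((\<integral>y. weight y \<partial>\<nu>) * (1 + X) - X)"
  proof -
    have "0 \<le> X"
      unfolding X_def using weight_nonneg b_nonneg by simp
    then have "1 * (1 + X) \<le> (\<integral>y. weight y \<partial>\<nu>) * (1 + X)"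
      using integral_weight_ge_1 by (intro mult_right_mono) auto
    then show ?thesis
      by simp
  qed
  also have "\<dots> = (\<integral>y. exp (- X) * (weight y * (1 + X) - weight y * b y) \<partial>\<nu>)"
    using integrable_weight int_wb by (simp add: X_def)
  also have "\<dots> \<le> (\<integral>y. weight y * exp (- b y) \<partial>\<nu>)"
  proof (rule Bochner_Integration.integral_mono)
    fix y
    \<comment> \<open>Jensen's inequality via the tangent line of \<open>exp (- b)\<close> at
      \<open>b = X\<close>.\<close>
    have "exp (- X) * (1 + (X - b y)) \<le> exp (- X) * exp (X - b y)"
      by (intro mult_left_mono exp_ge_add_one_self) auto
    also have "\<dots> = exp (- b y)"
      by (simp flip: exp_add)
    finally have "weight y * (exp (- X) * (1 + (X - b y))) \<le> weight y * exp (- b y)"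
      using weight_nonneg by (rule mult_left_mono)
    then show "exp (- X) * (weight y * (1 + X) - weight y * b y) \<le> weight y * exp (- b y)"
      by (simp add: algebra_simps)
  qed (use integrable_weight int_wb int_we in auto)
  finally have "ennreal ((h s * h (sqrt 2 * s)) ^ m) \<le> ennreal (\<integral>y. weight y * exp (- b y) \<partial>\<nu>)"
    by (rule ennreal_leI)
  also have "\<dots> = (\<integral>\<^sup>+y. ennreal (weight y * exp (- b y)) \<partial>\<nu>)"
    using int_we weight_nonneg by (intro nn_integral_eq_integral[symmetric]) auto
  finally show ?thesis
    by (simp add: b_def)
qed

text \<open>Substitution \<open>t = s * \<bar>y\<bar>\<close>. Up to \<open>pi\<close> the exponent
  is quadratic and \<open>y\<close> cancels from the tail bound; beyond \<open>pi\<close>,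
  \<open>nn_integral_osc\<close> gives a multiple of \<open>y^6 / (m * q^4)\<close>. Since
  \<open>\<bar>y\<bar> \<le> 4 * q\<close>, the cut-off \<open>sqrt m / q^2\<close> makes this of
  order \<open>q^2 / m\<close>.\<close>

lemma nn_integral_osc_scaled:
  fixes m y :: real
  assumes "0 < m" "y \<noteq> 0" "\<bar>y\<bar> \<le> 4 * q"
  shows "(\<integral>\<^sup>+s\<in>{1 / (2 * q)<..sqrt m / q\<^sup>2}. ennreal (exp (- (m / y\<^sup>2) * osc (s * y)) / s) \<partial>lborel)
    \<le> ennreal (10 ^ 11 * q\<^sup>2 / m)"
proof -
  define N where "N = m / y\<^sup>2"
  have N: "0 < N"
    using assms by (simp add: N_def)
  let ?s = "1 / (2 * q)" and ?L = "sqrt m / q\<^sup>2 * \<bar>y\<bar>"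
  have osc_abs: "osc (s * y) = osc (\<bar>y\<bar> * s)" for s
    by (cases "0 \<le> y") (auto simp: mult.commute simp flip: osc_minus[of "y * s"])
  have "(\<integral>\<^sup>+s\<in>{?s<..sqrt m / q\<^sup>2}. ennreal (exp (- (m / y\<^sup>2) * osc (s * y)) / s) \<partial>lborel)
      = (\<integral>\<^sup>+s\<in>{?s * \<bar>y\<bar> / \<bar>y\<bar><..?L / \<bar>y\<bar>}. ennreal (exp (- N * osc (\<bar>y\<bar> * s)) / s) \<partial>lborel)"
    using assms by (simp add: osc_abs N_def)
  also have "\<dots> = (\<integral>\<^sup>+t\<in>{?s * \<bar>y\<bar><..?L}. ennreal (exp (- N * osc t) / t) \<partial>lborel)"
    by (rule nn_integral_Ioc_scale[symmetric, of "\<bar>y\<bar>" "\<lambda>t. exp (- N * osc t)"]) (use assms in auto)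
  also have "\<dots> \<le> (\<integral>\<^sup>+t. ennreal (exp (- (N / 25 * t\<^sup>2)) / t) * indicator {?s * \<bar>y\<bar>..} t
      + ennreal (exp (- N * osc t) / t) * indicator {pi<..?L} t \<partial>lborel)"
  proof (intro nn_integral_mono)
    fix t
    show "ennreal (exp (- N * osc t) / t) * indicator {?s * \<bar>y\<bar><..?L} t
        \<le> ennreal (exp (- (N / 25 * t\<^sup>2)) / t) * indicator {?s * \<bar>y\<bar>..} t
          + ennreal (exp (- N * osc t) / t) * indicator {pi<..?L} t"
    proof (cases "t \<in> {?s * \<bar>y\<bar><..?L} \<and> t \<le> pi")
      case True
      then have t0: "0 < t"
        using q_ge_1 by (auto intro: le_less_trans[rotated])
      then have "N * (t\<^sup>2 / 25) \<le> N * osc t"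
        using True N by (intro mult_left_mono osc_ge_square) auto
      then have "exp (- N * osc t) / t \<le> exp (- (N / 25 * t\<^sup>2)) / t"
        using t0 by (intro divide_right_mono) auto
      then show ?thesis
        using True by (simp add: ennreal_leI)
    qed (auto simp: indicator_def)
  qed
  also have "\<dots> = (\<integral>\<^sup>+t\<in>{?s * \<bar>y\<bar>..}. ennreal (exp (- (N / 25 * t\<^sup>2)) / t) \<partial>lborel)
      + (\<integral>\<^sup>+t\<in>{pi<..?L}. ennreal (exp (- N * osc t) / t) \<partial>lborel)"
    by (rule nn_integral_add) measurable
  also have "\<dots> \<le> ennreal (1 / (2 * (N / 25) * (?s * \<bar>y\<bar>)\<^sup>2)) + ennreal (10 ^ 7 * ?L\<^sup>2 / N\<^sup>2)"
    using N assms q_ge_1 by (intro add_mono nn_integral_gaussian_tail nn_integral_osc) auto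
  also have "\<dots> = ennreal (1 / (2 * (N / 25) * (?s * \<bar>y\<bar>)\<^sup>2) + 10 ^ 7 * ?L\<^sup>2 / N\<^sup>2)"
    using N by (intro ennreal_plus[symmetric]) auto
  also have "\<dots> \<le> ennreal (50 * (q\<^sup>2 / m) + 10 ^ 7 * (4096 * (q\<^sup>2 / m)))"
  proof (intro ennreal_leI add_mono)
    show "1 / (2 * (N / 25) * (?s * \<bar>y\<bar>)\<^sup>2) \<le> 50 * (q\<^sup>2 / m)"
      using assms q_ge_1 by (simp add: N_def power_mult_distrib power_divide)
    have "\<bar>y\<bar> ^ 6 \<le> (4 * q) ^ 6"
      using assms by (intro power_mono) auto
    then have "y ^ 6 \<le> 4096 * q ^ 6"
      by (simp add: power_mult_distrib)
    then have "y ^ 6 / (m * q ^ 4) \<le> 4096 * q ^ 6 / (m * q ^ 4)"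
      using assms q_ge_1 by (intro divide_right_mono) auto
    moreover have "?L\<^sup>2 / N\<^sup>2 = y ^ 6 / (m * q ^ 4)"
    proof -
      have L: "?L\<^sup>2 = m * y\<^sup>2 / (q\<^sup>2)\<^sup>2"
        using assms by (simp add: power_mult_distrib power_divide)
      show ?thesis
        unfolding L using assms by (simp add: N_def power_divide eval_nat_numeral)
    qed
    moreover have "4096 * q ^ 6 / (m * q ^ 4) = 4096 * (q\<^sup>2 / m)"
      using q_ge_1 by (simp add: eval_nat_numeral)
    ultimately have "?L\<^sup>2 / N\<^sup>2 \<le> 4096 * (q\<^sup>2 / m)"
      by simp
    then show "10 ^ 7 * ?L\<^sup>2 / N\<^sup>2 \<le> 10 ^ 7 * (4096 * (q\<^sup>2 / m))"
      by simp
  qed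
  also have "\<dots> \<le> ennreal (10 ^ 11 * q\<^sup>2 / m)"
    using assms by (intro ennreal_leI) (simp add: divide_right_mono flip: add_divide_distrib)
  finally show ?thesis .
qed

text \<open>After \<open>block_power_le\<close>, Tonelli's theorem allows integration over
  \<open>s\<close> first, where the bound is uniform in \<open>y\<close>; the weight then
  contributes at most 2.\<close>

lemma nn_integral_large_frequency:
  fixes m :: nat
  assumes "0 < m"
  shows "(\<integral>\<^sup>+s\<in>{1 / (2 * q)<..sqrt m / q\<^sup>2}. ennreal ((h s * h (sqrt 2 * s)) ^ m / s) \<partial>lborel)
    \<le> ennreal (2 * 10 ^ 11 * q\<^sup>2 / m)"
proof -
  let ?I = "{1 / (2 * q)<..sqrt m / q\<^sup>2}"
  let ?f = "\<lambda>s y. ennreal (weight y * (exp (- (m / y\<^sup>2) * osc (s * y)) / s)) * indicator ?I s"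
  interpret P: pair_sigma_finite lborel \<nu> ..
  have meas: "(\<lambda>(s, y). ?f s y) \<in> borel_measurable (lborel \<Otimes>\<^sub>M \<nu>)"
    by measurable
  have "(\<integral>\<^sup>+s\<in>?I. ennreal ((h s * h (sqrt 2 * s)) ^ m / s) \<partial>lborel)
      \<le> (\<integral>\<^sup>+s. (\<integral>\<^sup>+y. ?f s y \<partial>\<nu>) \<partial>lborel)"
  proof (intro nn_integral_mono)
    fix s :: real
    show "ennreal ((h s * h (sqrt 2 * s)) ^ m / s) * indicator ?I s \<le> (\<integral>\<^sup>+y. ?f s y \<partial>\<nu>)"
    proof (cases "s \<in> ?I")
      case True
      have s: "0 < s"
        using True q_ge_1 by (auto intro: le_less_trans[rotated])
      have "ennreal ((h s * h (sqrt 2 * s)) ^ m / s) = ennreal ((h s * h (sqrt 2 * s)) ^ m) * ennreal (1 / s)"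
        using s h_nonneg by (subst ennreal_mult'[symmetric]) auto
      also have "\<dots> \<le> (\<integral>\<^sup>+y. ennreal (weight y * exp (- (m / y\<^sup>2) * osc (s * y))) \<partial>\<nu>) * ennreal (1 / s)"
        by (intro mult_right_mono block_power_le) auto
      also have "\<dots> = (\<integral>\<^sup>+y. ennreal (weight y * exp (- (m / y\<^sup>2) * osc (s * y))) * ennreal (1 / s) \<partial>\<nu>)"
        by (rule nn_integral_multc[symmetric]) measurable
      also have "\<dots> = (\<integral>\<^sup>+y. ?f s y \<partial>\<nu>)"
        using True s weight_nonneg by (intro nn_integral_cong) (simp flip: ennreal_mult')
      finally show ?thesis
        using True by simp
    qed simp
  qed
  also have "\<dots> = (\<integral>\<^sup>+y. (\<integral>\<^sup>+s. ?f s y \<partial>lborel) \<partial>\<nu>)"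
    using P.Fubini[OF meas] by simp
  also have "\<dots> \<le> (\<integral>\<^sup>+y. ennreal (10 ^ 11 * q\<^sup>2 / m) * ennreal (weight y) \<partial>\<nu>)"
  proof (intro nn_integral_mono)
    fix y
    have "(\<integral>\<^sup>+s. ?f s y \<partial>lborel)
        = (\<integral>\<^sup>+s. ennreal (weight y) * (ennreal (exp (- (m / y\<^sup>2) * osc (s * y)) / s) * indicator ?I s) \<partial>lborel)"
      using weight_nonneg[of y]
      by (intro nn_integral_cong) (simp only: times_divide_eq_right[symmetric] ennreal_mult' mult.assoc)
    also have "\<dots> = ennreal (weight y) * (\<integral>\<^sup>+s\<in>?I. ennreal (exp (- (m / y\<^sup>2) * osc (s * y)) / s) \<partial>lborel)"
      by (rule nn_integral_cmult) measurable
    also have "\<dots> \<le> ennreal (weight y) * ennreal (10 ^ 11 * q\<^sup>2 / m)"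
    proof (cases "weight y = 0")
      case False
      then have "y \<noteq> 0" "\<bar>y\<bar> \<le> 4 * q"
        by (auto simp: weight_def indicator_def split: if_splits)
      then show ?thesis
        using assms by (intro mult_left_mono nn_integral_osc_scaled) auto
    qed simp
    finally show "(\<integral>\<^sup>+s. ?f s y \<partial>lborel) \<le> ennreal (10 ^ 11 * q\<^sup>2 / m) * ennreal (weight y)"
      by (simp add: mult.commute)
  qed
  also have "\<dots> = ennreal (10 ^ 11 * q\<^sup>2 / m) * (\<integral>\<^sup>+y. ennreal (weight y) \<partial>\<nu>)"
    by (rule nn_integral_cmult) simp
  also have "(\<integral>\<^sup>+y. ennreal (weight y) \<partial>\<nu>) = ennreal (\<integral>y. weight y \<partial>\<nu>)"
    using integrable_weight weight_nonneg by (intro nn_integral_eq_integral) auto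
  also have "ennreal (10 ^ 11 * q\<^sup>2 / m) * \<dots> \<le> ennreal (10 ^ 11 * q\<^sup>2 / m) * ennreal 2"
    by (intro mult_left_mono ennreal_leI integral_weight_le_2) auto
  also have "\<dots> = ennreal (2 * 10 ^ 11 * q\<^sup>2 / m)"
    by (subst ennreal_mult'[symmetric]) (simp_all add: mult_ac)
  finally show ?thesis .
qed

text \<open>The range is split at \<open>1 / (2 * q)\<close>. Above it the block and the Gaussian
  are both small and are estimated separately.\<close>

lemma nn_integral_block_approx:
  fixes m :: nat
  assumes "0 < m"
  shows "(\<integral>\<^sup>+s\<in>{0<..sqrt m / q\<^sup>2}. ennreal (\<bar>(h s * h (sqrt 2 * s)) ^ m - exp (- (3 * real m * s\<^sup>2))\<bar> / s) \<partial>lborel)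
    \<le> ennreal (10 ^ 12 * q\<^sup>2 / m)"
proof -
  let ?a = "1 / (2 * q)" and ?b = "sqrt m / q\<^sup>2"
  let ?B = "\<lambda>s. (h s * h (sqrt 2 * s)) ^ m" and ?G = "\<lambda>s::real. exp (- (3 * real m * s\<^sup>2))"
  have a: "0 < ?a"
    using q_ge_1 by simp
  have "(\<integral>\<^sup>+s\<in>{0<..?b}. ennreal (\<bar>?B s - ?G s\<bar> / s) \<partial>lborel)
      \<le> (\<integral>\<^sup>+s. ennreal (\<bar>?B s - ?G s\<bar> / s) * indicator {0<..?a} s
        + (ennreal (?B s / s) * indicator {?a<..?b} s + ennreal (?G s / s) * indicator {?a..} s) \<partial>lborel)"
  proof (intro nn_integral_mono)
    fix s :: real
    show "ennreal (\<bar>?B s - ?G s\<bar> / s) * indicator {0<..?b} s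
        \<le> ennreal (\<bar>?B s - ?G s\<bar> / s) * indicator {0<..?a} s
          + (ennreal (?B s / s) * indicator {?a<..?b} s + ennreal (?G s / s) * indicator {?a..} s)"
    proof (cases "s \<in> {?a<..?b}")
      case True
      then have "?a < s"
        by simp
      with a have s: "0 < s"
        by (rule less_trans)
      have B: "0 \<le> ?B s"
        using h_nonneg by simp
      then have "\<bar>?B s - ?G s\<bar> \<le> ?B s + ?G s"
        using abs_triangle_ineq4[of "?B s" "?G s"] by simp
      then have "\<bar>?B s - ?G s\<bar> / s \<le> ?B s / s + ?G s / s"
        using s by (simp add: divide_right_mono flip: add_divide_distrib)
      then have "ennreal (\<bar>?B s - ?G s\<bar> / s) \<le> ennreal (?B s / s + ?G s / s)"
        by (rule ennreal_leI)
      also have "\<dots> = ennreal (?B s / s) + ennreal (?G s / s)"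
        using s B by (intro ennreal_plus) auto
      finally show ?thesis
        using True s by (auto simp: indicator_def)
    qed (auto simp: indicator_def)
  qed
  also have "\<dots> = (\<integral>\<^sup>+s\<in>{0<..?a}. ennreal (\<bar>?B s - ?G s\<bar> / s) \<partial>lborel)
      + (\<integral>\<^sup>+s. ennreal (?B s / s) * indicator {?a<..?b} s + ennreal (?G s / s) * indicator {?a..} s \<partial>lborel)"
    by (rule nn_integral_add) measurable
  also have "(\<integral>\<^sup>+s. ennreal (?B s / s) * indicator {?a<..?b} s + ennreal (?G s / s) * indicator {?a..} s \<partial>lborel)
      = (\<integral>\<^sup>+s\<in>{?a<..?b}. ennreal (?B s / s) \<partial>lborel) + (\<integral>\<^sup>+s\<in>{?a..}. ennreal (?G s / s) \<partial>lborel)"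
    by (rule nn_integral_add) measurable
  also have "(\<integral>\<^sup>+s\<in>{0<..?a}. ennreal (\<bar>?B s - ?G s\<bar> / s) \<partial>lborel) + \<dots>
      \<le> ennreal (15 * q\<^sup>2 / m) + (ennreal (2 * 10 ^ 11 * q\<^sup>2 / m) + ennreal (1 / (2 * (3 * real m) * ?a\<^sup>2)))"
  proof (intro add_mono nn_integral_small_frequency nn_integral_large_frequency assms)
    show "(\<integral>\<^sup>+s\<in>{?a..}. ennreal (?G s / s) \<partial>lborel) \<le> ennreal (1 / (2 * (3 * real m) * ?a\<^sup>2))"
      by (rule nn_integral_gaussian_tail) (use assms a in simp_all)
  qed
  also have "\<dots> = ennreal (15 * q\<^sup>2 / m + (2 * 10 ^ 11 * q\<^sup>2 / m + 1 / (2 * (3 * real m) * ?a\<^sup>2)))"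
  proof -
    have "ennreal x + (ennreal y + ennreal z) = ennreal (x + (y + z))" if "0 \<le> x" "0 \<le> y" "0 \<le> z" for x y z
      using that by simp
    then show ?thesis
      by this auto
  qed
  also have "\<dots> \<le> ennreal (10 ^ 12 * q\<^sup>2 / m)"
  proof (rule ennreal_leI)
    have "1 / (2 * (3 * real m) * ?a\<^sup>2) = 2 / 3 * q\<^sup>2 / m"
      by (simp add: power_mult_distrib power_divide)
    then have "15 * q\<^sup>2 / m + (2 * 10 ^ 11 * q\<^sup>2 / m + 1 / (2 * (3 * real m) * ?a\<^sup>2))
        = (15 + (2 * 10 ^ 11 + 2 / 3)) * (q\<^sup>2 / m)"
      by (simp add: distrib_right)
    also have "\<dots> \<le> 10 ^ 12 * (q\<^sup>2 / m)"
      by (intro mult_right_mono) auto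
    finally show "15 * q\<^sup>2 / m + (2 * 10 ^ 11 * q\<^sup>2 / m + 1 / (2 * (3 * real m) * ?a\<^sup>2)) \<le> 10 ^ 12 * q\<^sup>2 / m"
      by simp
  qed
  finally show ?thesis .
qed

end

section \<open>Symmetrization and conclusion\<close>

definition symmetrization :: "real measure \<Rightarrow> real measure" where
  "symmetrization \<mu> = distr (\<mu> \<Otimes>\<^sub>M \<mu>) borel (\<lambda>(x, y). x - y)"

context real_distribution
begin

interpretation P: pair_prob_space M M ..

lemma integral_symmetrization:
  fixes f :: "real \<Rightarrow> real"
  assumes "f \<in> borel_measurable borel"
  shows "(\<integral>y. f y \<partial>symmetrization M) = (\<integral>p. f (fst p - snd p) \<partial>(M \<Otimes>\<^sub>M M))"
    and "integrable (symmetrization M) f \<longleftrightarrow> integrable (M \<Otimes>\<^sub>M M) (\<lambda>p. f (fst p - snd p))"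
  using assms unfolding symmetrization_def
  by (simp_all add: integral_distr integrable_distr_eq case_prod_unfold)

lemma
  fixes f :: "real \<Rightarrow> real"
  assumes f: "integrable M f" and [measurable]: "f \<in> borel_measurable borel"
  shows integrable_pair_fst: "integrable (M \<Otimes>\<^sub>M M) (\<lambda>p. f (fst p))"
    and integral_pair_fst: "(\<integral>p. f (fst p) \<partial>(M \<Otimes>\<^sub>M M)) = (\<integral>x. f x \<partial>M)"
    and integrable_pair_snd: "integrable (M \<Otimes>\<^sub>M M) (\<lambda>p. f (snd p))"
    and integral_pair_snd: "(\<integral>p. f (snd p) \<partial>(M \<Otimes>\<^sub>M M)) = (\<integral>x. f x \<partial>M)"
proof -
  show 1: "integrable (M \<Otimes>\<^sub>M M) (\<lambda>p. f (fst p))"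
    using f prob_space by (intro P.Fubini_integrable) auto
  show 2: "integrable (M \<Otimes>\<^sub>M M) (\<lambda>p. f (snd p))"
    using f prob_space by (intro P.Fubini_integrable) auto
  show "(\<integral>p. f (fst p) \<partial>(M \<Otimes>\<^sub>M M)) = (\<integral>x. f x \<partial>M)"
    using P.integral_fst'[OF 1] prob_space by simp
  show "(\<integral>p. f (snd p) \<partial>(M \<Otimes>\<^sub>M M)) = (\<integral>x. f x \<partial>M)"
    using P.integral_fst'[OF 2] prob_space by simp
qed

lemma
  fixes f g :: "real \<Rightarrow> real"
  assumes f: "integrable M f" and [measurable]: "f \<in> borel_measurable borel"
    and g: "integrable M g" and [measurable]: "g \<in> borel_measurable borel"
  shows integrable_pair_prod: "integrable (M \<Otimes>\<^sub>M M) (\<lambda>p. f (fst p) * g (snd p))"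
    and integral_pair_prod: "(\<integral>p. f (fst p) * g (snd p) \<partial>(M \<Otimes>\<^sub>M M)) = (\<integral>x. f x \<partial>M) * (\<integral>x. g x \<partial>M)"
proof -
  show 1: "integrable (M \<Otimes>\<^sub>M M) (\<lambda>p. f (fst p) * g (snd p))"
    using f g by (intro P.Fubini_integrable) (auto simp: abs_mult)
  show "(\<integral>p. f (fst p) * g (snd p) \<partial>(M \<Otimes>\<^sub>M M)) = (\<integral>x. f x \<partial>M) * (\<integral>x. g x \<partial>M)"
    using P.integral_fst'[OF 1] by simp
qed

text \<open>Expanding \<open>cos (s * (x - y))\<close> yields the squares of the real and imaginary
  parts of \<open>char M s\<close>. This is also the source of the nonnegativity assumed in
  \<open>symmetrized_law\<close>.\<close>

lemma symmetrization_cos: "(\<integral>y. cos (s * y) \<partial>symmetrization M) = (cmod (char M s))\<^sup>2"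
proof -
  have int: "integrable M (\<lambda>x. cos (s * x))" "integrable M (\<lambda>x. sin (s * x))"
    by (auto intro!: integrable_const_bound[where B = 1])
  have Re: "Re (char M s) = (\<integral>x. cos (s * x) \<partial>M)"
    unfolding char_def by (subst integral_Re[symmetric]) (auto intro!: integrable_iexp simp: Re_exp)
  have Im: "Im (char M s) = (\<integral>x. sin (s * x) \<partial>M)"
    unfolding char_def by (subst integral_Im[symmetric]) (auto intro!: integrable_iexp simp: Im_exp)
  have "(\<integral>y. cos (s * y) \<partial>symmetrization M)
      = (\<integral>p. cos (s * fst p) * cos (s * snd p) + sin (s * fst p) * sin (s * snd p) \<partial>(M \<Otimes>\<^sub>M M))"
    by (subst integral_symmetrization) (simp_all add: right_diff_distrib cos_diff)
  also have "\<dots> = (\<integral>p. cos (s * fst p) * cos (s * snd p) \<partial>(M \<Otimes>\<^sub>M M))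
      + (\<integral>p. sin (s * fst p) * sin (s * snd p) \<partial>(M \<Otimes>\<^sub>M M))"
    using integrable_pair_prod[OF int(1) _ int(1)] integrable_pair_prod[OF int(2) _ int(2)]
    by (intro Bochner_Integration.integral_add) auto
  also have "\<dots> = (cmod (char M s))\<^sup>2"
    unfolding cmod_power2 Re Im
    using integral_pair_prod[OF int(1) _ int(1)] integral_pair_prod[OF int(2) _ int(2)]
    by (simp add: power2_eq_square)
  finally show ?thesis .
qed

text \<open>The bound \<open>q \<ge> 1\<close> comes from integrating
  \<open>(x^2 - 1)^2 \<ge> 0\<close>. Mean zero removes the cross term in the second moment, and the
  constant 16 is \<open>8 + 8\<close> from the convexity bound \<open>le8\<close>.\<close>

lemma symmetrized_law_symmetrization:
  assumes int1: "integrable M (\<lambda>x. x)" and int2: "integrable M (\<lambda>x. x\<^sup>2)" and int4: "integrable M (\<lambda>x. x ^ 4)"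
    and mean: "(\<integral>x. x \<partial>M) = 0" and var: "(\<integral>x. x\<^sup>2 \<partial>M) = 1"
    and fourth: "(\<integral>x. x ^ 4 \<partial>M) \<le> q\<^sup>2" and "0 \<le> q"
  shows "symmetrized_law (symmetrization M) q"
proof -
  have "(\<integral>x. 2 * x\<^sup>2 - 1 \<partial>M) \<le> (\<integral>x. x ^ 4 \<partial>M)"
  proof (rule Bochner_Integration.integral_mono)
    fix x :: real
    have "0 \<le> (x\<^sup>2 - 1)\<^sup>2"
      by simp
    then show "2 * x\<^sup>2 - 1 \<le> x ^ 4"
      by (simp add: power2_diff flip: power_mult)
  qed (use int2 int4 in auto)
  moreover have "(\<integral>x. 2 * x\<^sup>2 - 1 \<partial>M) = 1"
    using int2 var prob_space by simp
  ultimately have "1 \<le> q\<^sup>2"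
    using fourth by simp
  then have q: "1 \<le> q"
    using \<open>0 \<le> q\<close> power2_le_imp_le[of 1 q] by simp
  have "real_distribution (symmetrization M)"
    unfolding symmetrization_def by (intro P.real_distribution_distr) (simp add: case_prod_unfold)
  moreover have int8: "integrable (M \<Otimes>\<^sub>M M) (\<lambda>p. 8 * fst p ^ 4 + 8 * snd p ^ 4)"
    using integrable_pair_fst[OF int4] integrable_pair_snd[OF int4] by simp
  have le8: "(x - y) ^ 4 \<le> 8 * x ^ 4 + 8 * y ^ 4" for x y :: real
  proof -
    have "(x - y)\<^sup>2 \<le> 2 * (x\<^sup>2 + y\<^sup>2)"
      using zero_le_power2[of "x + y"] by (simp add: power2_diff power2_sum)
    then have "((x - y)\<^sup>2)\<^sup>2 \<le> (2 * (x\<^sup>2 + y\<^sup>2))\<^sup>2"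
      by (intro power_mono) auto
    also have "\<dots> \<le> 8 * (x\<^sup>2)\<^sup>2 + 8 * (y\<^sup>2)\<^sup>2"
      using zero_le_power2[of "x\<^sup>2 - y\<^sup>2"] by (simp add: power2_diff power2_sum power_mult_distrib)
    finally show ?thesis
      by (simp flip: power_mult)
  qed
  have int_diff4: "integrable (M \<Otimes>\<^sub>M M) (\<lambda>p. (fst p - snd p) ^ 4)"
    using le8 by (intro Bochner_Integration.integrable_bound[OF int8]) auto
  then have "integrable (symmetrization M) (\<lambda>y. y ^ 4)"
    by (subst integral_symmetrization) auto
  moreover have "(\<integral>y. y\<^sup>2 \<partial>symmetrization M) = 2"
  proof -
    have "(\<integral>y. y\<^sup>2 \<partial>symmetrization M)
        = (\<integral>p. (fst p)\<^sup>2 + (snd p)\<^sup>2 - 2 * (fst p * snd p) \<partial>(M \<Otimes>\<^sub>M M))"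
      by (subst integral_symmetrization) (simp_all add: power2_diff mult.assoc)
    also have "\<dots> = 1 + 1 - 2 * (0 * 0)"
      using integrable_pair_fst[OF int2] integrable_pair_snd[OF int2] integrable_pair_prod[OF int1 _ int1]
        integral_pair_fst[OF int2] integral_pair_snd[OF int2] integral_pair_prod[OF int1 _ int1] mean var
      by simp
    finally show ?thesis by simp
  qed
  moreover have "(\<integral>y. y ^ 4 \<partial>symmetrization M) \<le> 16 * q\<^sup>2"
  proof -
    have "(\<integral>y. y ^ 4 \<partial>symmetrization M) = (\<integral>p. (fst p - snd p) ^ 4 \<partial>(M \<Otimes>\<^sub>M M))"
      by (rule integral_symmetrization) simp
    also have "\<dots> \<le> (\<integral>p. 8 * fst p ^ 4 + 8 * snd p ^ 4 \<partial>(M \<Otimes>\<^sub>M M))"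
      by (intro Bochner_Integration.integral_mono int_diff4 int8 le8)
    also have "\<dots> = 8 * (\<integral>x. x ^ 4 \<partial>M) + 8 * (\<integral>x. x ^ 4 \<partial>M)"
      using integrable_pair_fst[OF int4] integrable_pair_snd[OF int4]
        integral_pair_fst[OF int4] integral_pair_snd[OF int4] by simp
    finally show ?thesis
      using fourth by simp
  qed
  ultimately show ?thesis
    using q symmetrization_cos by (simp add: symmetrized_law_def symmetrized_law_axioms_def)
qed

lemma char_uminus: "char M (- s) = cnj (char M s)"
  unfolding char_def by (subst Bochner_Integration.integral_cnj[symmetric]) (auto simp: exp_cnj)

end

lemma prod_blocks_of_four:
  fixes g :: "nat \<Rightarrow> 'a :: comm_monoid_mult"
  shows "(\<Prod>j=1..4 * m. g (j mod 4)) = (g 1 * g 2 * g 3 * g 0) ^ m"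
proof (induction m)
  case (Suc m)
  have "{1..4 * Suc m} = insert (4 * m + 4) (insert (4 * m + 3) (insert (4 * m + 2) (insert (4 * m + 1) {1..4 * m})))"
    by auto
  moreover have "(4 * m + 1) mod 4 = 1" "(4 * m + 2) mod 4 = 2" "(4 * m + 3) mod 4 = 3" "(4 * m + 4) mod 4 = 0"
    by presburger+
  ultimately show ?case
    using Suc by (simp add: mult_ac)
qed simp

lemma iid_standardizedD:
  assumes "iid_standardized M n X \<delta>"
  shows "prob_space M"
    and "prob_space.indep_vars M (\<lambda>_. borel) X {1..n}"
    and "\<And>j. j \<in> {1..n} \<Longrightarrow> distr M borel (X j) = distr M borel (X 1)"
    and "\<And>j. j \<in> {1..n} \<Longrightarrow> integrable M (X j)"
    and "\<And>j. j \<in> {1..n} \<Longrightarrow> (\<integral>\<omega>. X j \<omega> \<partial>M) = 0"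
    and "\<And>j. j \<in> {1..n} \<Longrightarrow> (\<integral>\<omega>. (X j \<omega>)\<^sup>2 \<partial>M) = 1"
    and "integrable M (\<lambda>\<omega>. \<bar>X 1 \<omega>\<bar> ^ 4)"
    and "(\<integral>\<omega>. \<bar>X 1 \<omega>\<bar> ^ 4 \<partial>M) \<le> \<delta> ^ 4"
proof -
  note iid = assms[unfolded iid_standardized_def]
  show "prob_space M" "prob_space.indep_vars M (\<lambda>_. borel) X {1..n}"
      "integrable M (\<lambda>\<omega>. \<bar>X 1 \<omega>\<bar> ^ 4)" "(\<integral>\<omega>. \<bar>X 1 \<omega>\<bar> ^ 4 \<partial>M) \<le> \<delta> ^ 4"
    using iid by blast+
  fix j assume j: "j \<in> {1..n}"
  show "distr M borel (X j) = distr M borel (X 1)" "integrable M (X j)"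
    using iid j by blast+
  show mean: "(\<integral>\<omega>. X j \<omega> \<partial>M) = 0"
    using iid j by blast
  have "(\<integral>\<omega>. (X j \<omega> - (\<integral>\<omega>. X j \<omega> \<partial>M))\<^sup>2 \<partial>M) = 1"
    using iid j by blast
  then show "(\<integral>\<omega>. (X j \<omega>)\<^sup>2 \<partial>M) = 1"
    unfolding mean by simp
qed

text \<open>With \<open>n = 4 * m\<close> the normalization \<open>sqrt (3 * n / 2)\<close> is
  \<open>sqrt (6 * m)\<close> and cancels. Opposite coefficients in a block give conjugate factors,
  which pair to squared moduli; the fourth coefficient belongs to residue 0.\<close>

lemma char_theta_sum:
  assumes iid: "iid_standardized M (4 * m) X \<delta>" and "0 < m"
  defines "\<mu> \<equiv> distr M borel (X 1)"
  shows "char (distr M borel (\<lambda>\<omega>. \<Sum>j=1..4 * m. theta (4 * m) j * X j \<omega>)) (sqrt (6 * m) * s)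
    = complex_of_real (((cmod (char \<mu> s))\<^sup>2 * (cmod (char \<mu> (sqrt 2 * s)))\<^sup>2) ^ m)"
proof -
  interpret prob_space M
    using iid by (rule iid_standardizedD)
  let ?n = "4 * m"
  have indep: "indep_vars (\<lambda>_. borel) X {1..?n}"
    and same: "\<And>j. j \<in> {1..?n} \<Longrightarrow> distr M borel (X j) = \<mu>"
    using iid_standardizedD(2,3)[OF iid] unfolding \<mu>_def by blast+
  have rv: "X j \<in> borel_measurable M" if "j \<in> {1..?n}" for j
    using indep that by (auto simp: indep_vars_def)
  have "X 1 \<in> borel_measurable M"
    using rv \<open>0 < m\<close> by simp
  then interpret mu: real_distribution \<mu>
    unfolding \<mu>_def by (rule real_distribution_distr)
  define c where "c j = (if j = 1 then 1 else if j = 2 then sqrt 2 else if j = 3 then - 1 else - sqrt 2)" for j :: nat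
  have theta: "theta ?n j * (sqrt (6 * m) * s) = c (j mod 4) * s" for j
    using \<open>0 < m\<close> by (simp add: theta_def c_def)
  have scale: "char (distr M borel (\<lambda>\<omega>. a * X j \<omega>)) t = char \<mu> (a * t)" if "j \<in> {1..?n}" for a j t
  proof -
    have "char (distr M borel (\<lambda>\<omega>. a * X j \<omega>)) t = char (distr M borel (X j)) (a * t)"
      using rv[OF that] by (simp add: char_def integral_distr mult_ac)
    then show ?thesis
      using same[OF that] by simp
  qed
  have "indep_vars (\<lambda>_. borel) (\<lambda>j \<omega>. theta ?n j * X j \<omega>) {1..?n}"
    by (rule indep_vars_compose2[OF indep, where Y = "\<lambda>j x. theta ?n j * x"]) simp
  then have "char (distr M borel (\<lambda>\<omega>. \<Sum>j=1..?n. theta ?n j * X j \<omega>)) (sqrt (6 * m) * s)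
      = (\<Prod>j=1..?n. char (distr M borel (\<lambda>\<omega>. theta ?n j * X j \<omega>)) (sqrt (6 * m) * s))"
    by (rule char_distr_sum)
  also have "\<dots> = (\<Prod>j=1..?n. char \<mu> (c (j mod 4) * s))"
    by (intro prod.cong refl) (simp only: scale theta)
  also have "\<dots> = (char \<mu> (c 1 * s) * char \<mu> (c 2 * s) * char \<mu> (c 3 * s) * char \<mu> (c 0 * s)) ^ m"
    by (rule prod_blocks_of_four)
  also have "char \<mu> (c 1 * s) * char \<mu> (c 2 * s) * char \<mu> (c 3 * s) * char \<mu> (c 0 * s)
      = (char \<mu> s * cnj (char \<mu> s)) * (char \<mu> (sqrt 2 * s) * cnj (char \<mu> (sqrt 2 * s)))"
    by (simp add: c_def mu.char_uminus mult_ac)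
  also have "\<dots> = complex_of_real ((cmod (char \<mu> s))\<^sup>2 * (cmod (char \<mu> (sqrt 2 * s)))\<^sup>2)"
    by (simp only: of_real_mult complex_norm_square)
  finally show ?thesis
    by simp
qed

text \<open>The smoothing inequality enters as a hypothesis, so the resulting constant is an
  explicit multiple of \<open>C\<close>, the same for every \<open>M\<close>.\<close>

lemma berry_esseen_theta:
  assumes C: "0 < C" "\<And>\<mu> T \<epsilon> x. \<lbrakk>real_distribution \<mu>; integrable \<mu> (\<lambda>x. x); 0 < T; 0 \<le> \<epsilon>;
      (\<integral>\<^sup>+t\<in>{0<..T}. ennreal (cmod (char \<mu> t - char std_normal_distribution t) / t) \<partial>lborel) \<le> ennreal \<epsilon>\<rbrakk>
      \<Longrightarrow> \<bar>cdf \<mu> x - cdf std_normal_distribution x\<bar> \<le> C * (\<epsilon> + 1 / T)"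
  shows "berry_esseen_on M (8 * C * (10 ^ 12 + 1))"
  unfolding berry_esseen_on_def
proof (intro allI impI, elim conjE)
  fix n :: nat and \<delta> :: real and X :: "nat \<Rightarrow> 'a \<Rightarrow> real"
  assume n: "4 \<le> n" "4 dvd n" and \<delta>: "0 < \<delta>" and iid: "iid_standardized M n X \<delta>"
  obtain m where m: "n = 4 * m"
    using n by (elim dvdE)
  then have m0: "0 < m"
    using n by simp
  interpret prob_space M
    using iid by (rule iid_standardizedD)
  note int = iid_standardizedD(4)[OF iid]
    and mean = iid_standardizedD(5)[OF iid] and var = iid_standardizedD(6)[OF iid]
    and int4 = iid_standardizedD(7)[OF iid] and fourth = iid_standardizedD(8)[OF iid]
  have one: "1 \<in> {1..n}"
    using n by simp
  have rv[measurable]: "X 1 \<in> borel_measurable M"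
    using int[OF one] by simp
  define \<mu> where "\<mu> = distr M borel (X 1)"
  interpret mu: real_distribution \<mu>
    unfolding \<mu>_def by (rule real_distribution_distr[OF rv])
  have "symmetrized_law (symmetrization \<mu>) (\<delta>\<^sup>2)"
  proof (rule mu.symmetrized_law_symmetrization)
    show "integrable \<mu> (\<lambda>x. x)" "(\<integral>x. x \<partial>\<mu>) = 0"
      unfolding \<mu>_def using int[OF one] mean[OF one] by (simp_all add: integrable_distr_eq integral_distr del: One_nat_def)
    have "integrable M (\<lambda>\<omega>. (X 1 \<omega>)\<^sup>2)"
    proof (rule Bochner_Integration.integrable_bound)
      show "integrable M (\<lambda>\<omega>. 1 + \<bar>X 1 \<omega>\<bar> ^ 4)"
        using int4 by simp
      show "AE \<omega> in M. norm ((X 1 \<omega>)\<^sup>2) \<le> norm (1 + \<bar>X 1 \<omega>\<bar> ^ 4)"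
      proof (intro AE_I2)
        fix \<omega>
        have "0 \<le> ((X 1 \<omega>)\<^sup>2 - 1)\<^sup>2"
          by simp
        then have "2 * (X 1 \<omega>)\<^sup>2 \<le> 1 + X 1 \<omega> ^ 4"
          by (simp add: power2_diff flip: power_mult)
        then have "(X 1 \<omega>)\<^sup>2 \<le> 1 + X 1 \<omega> ^ 4"
          using zero_le_power2[of "X 1 \<omega>"] by linarith
        then show "norm ((X 1 \<omega>)\<^sup>2) \<le> norm (1 + \<bar>X 1 \<omega>\<bar> ^ 4)"
          by simp
      qed
    qed (rule borel_measurable_power[OF rv])
    then show "integrable \<mu> (\<lambda>x. x\<^sup>2)"
      unfolding \<mu>_def by (simp add: integrable_distr_eq del: One_nat_def)
    show "(\<integral>x. x\<^sup>2 \<partial>\<mu>) = 1"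
      unfolding \<mu>_def using var[OF one] by (simp add: integral_distr del: One_nat_def)
    show "integrable \<mu> (\<lambda>x. x ^ 4)"
      unfolding \<mu>_def using int4 by (simp add: integrable_distr_eq del: One_nat_def)
    show "(\<integral>x. x ^ 4 \<partial>\<mu>) \<le> (\<delta>\<^sup>2)\<^sup>2"
      unfolding \<mu>_def using fourth by (simp add: integral_distr del: One_nat_def flip: power_mult)
  qed simp
  then interpret S: symmetrized_law "symmetrization \<mu>" "\<delta>\<^sup>2" .
  have h: "S.h s = (cmod (char \<mu> s))\<^sup>2" for s
    unfolding S.h_def by (rule mu.symmetrization_cos)
  let ?S = "\<lambda>\<omega>. \<Sum>j=1..n. theta n j * X j \<omega>"
  let ?\<rho> = "distr M borel ?S" and ?c = "sqrt (6 * m)" and ?\<epsilon> = "10 ^ 12 * (\<delta>\<^sup>2)\<^sup>2 / m"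
  let ?L = "sqrt m / (\<delta>\<^sup>2)\<^sup>2"
  \<comment> \<open>The cut-off in \<open>s\<close> from \<open>S.nn_integral_block_approx\<close>,
    rescaled to the frequency of the sum; it makes \<open>1 / T\<close> at most
    \<open>\<delta>^4 / m\<close>.\<close>
  define T where "T = ?c * ?L"
  have c: "0 < ?c"
    using m0 by simp
  have T: "0 < T" "T / ?c = ?L"
    using m0 \<delta> by (simp_all add: T_def)
  have S_meas[measurable]: "?S \<in> borel_measurable M" and int_S: "integrable M ?S"
    using int by (auto intro!: borel_measurable_sum)
  have rho: "real_distribution ?\<rho>"
    by (rule real_distribution_distr) measurable
  have [measurable]: "char ?\<rho> \<in> borel_measurable borel" "char std_normal_distribution \<in> borel_measurable borel"
    using rho real_dist_normal_dist by (auto intro: real_distribution.char_measurable)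
  have char: "char ?\<rho> (?c * s) = complex_of_real ((S.h s * S.h (sqrt 2 * s)) ^ m)" for s
    unfolding h using char_theta_sum[of M m X \<delta> s] iid m0 unfolding m \<mu>_def by simp
  have normal: "char std_normal_distribution (?c * s) = complex_of_real (exp (- (3 * real m * s\<^sup>2)))" for s
    unfolding char_std_normal_distribution by (simp add: power_mult_distrib)
  have "(\<integral>\<^sup>+t\<in>{0<..T}. ennreal (cmod (char ?\<rho> t - char std_normal_distribution t) / t) \<partial>lborel)
      = (\<integral>\<^sup>+s\<in>{0 / ?c<..T / ?c}. ennreal (cmod (char ?\<rho> (?c * s) - char std_normal_distribution (?c * s)) / s) \<partial>lborel)"
    using c by (rule nn_integral_Ioc_scale) measurable
  also have "\<dots> = (\<integral>\<^sup>+s\<in>{0<..?L}. ennreal (\<bar>(S.h s * S.h (sqrt 2 * s)) ^ m - exp (- (3 * real m * s\<^sup>2))\<bar> / s) \<partial>lborel)"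
    unfolding T(2) char normal of_real_diff[symmetric] norm_of_real by simp
  also have "\<dots> \<le> ennreal ?\<epsilon>"
    using m0 by (rule S.nn_integral_block_approx)
  finally have close: "\<bar>cdf ?\<rho> x - cdf std_normal_distribution x\<bar> \<le> C * (?\<epsilon> + 1 / T)" for x
    using int_S T(1) by (intro C(2) rho) (simp_all add: integrable_distr_eq)
  have "normal_discrepancy M ?S \<le> 2 * (C * (?\<epsilon> + 1 / T))"
    by (rule normal_discrepancy_le[OF prob_space_axioms S_meas close])
  also have "\<dots> \<le> 2 * (C * (?\<epsilon> + (\<delta>\<^sup>2)\<^sup>2 / m))"
  proof -
    have "real m = sqrt m * sqrt m"
      by simp
    also have "\<dots> \<le> ?c * sqrt m"
      by (intro mult_right_mono) auto
    finally have "1 / T \<le> (\<delta>\<^sup>2)\<^sup>2 / m"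
      using m0 \<delta> by (simp add: T_def field_simps)
    then show ?thesis
      using C(1) by (intro mult_left_mono add_left_mono) auto
  qed
  \<comment> \<open>The factor 8 is 2 for the two endpoints times 4 from
    \<open>n = 4 * m\<close>.\<close>
  also have "\<dots> = 8 * C * (10 ^ 12 + 1) * \<delta> ^ 4 / n"
    using m0 by (simp add: m field_simps flip: power_mult)
  finally show "normal_discrepancy M ?S \<le> 8 * C * (10 ^ 12 + 1) * \<delta> ^ 4 / n" .
qed

text \<open>Only the joint law of the variables matters. It lives on the functions from
  \<open>nat\<close> to \<open>real\<close>, where the coordinates form an i.i.d. family with the
  same marginals and the same distribution of the sum.\<close>

lemma berry_esseen_on_transfer:
  fixes M :: "'a measure"
  assumes "\<forall>N :: (nat \<Rightarrow> real) measure. berry_esseen_on N C"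
  shows "berry_esseen_on M C"
  unfolding berry_esseen_on_def
proof (intro allI impI, elim conjE)
  fix n :: nat and \<delta> :: real and X :: "nat \<Rightarrow> 'a \<Rightarrow> real"
  assume n: "4 \<le> n" "4 dvd n" and \<delta>: "0 < \<delta>" and iid: "iid_standardized M n X \<delta>"
  let ?I = "{1..n}"
  interpret prob_space M
    using iid by (rule iid_standardizedD)
  have indep: "indep_vars (\<lambda>_. borel) X ?I"
    using iid by (rule iid_standardizedD)
  then have rv: "X j \<in> borel_measurable M" if "j \<in> ?I" for j
    using that by (auto simp: indep_vars_def)
  have I: "?I \<noteq> {}"
    using n by simp
  let ?P = "\<Pi>\<^sub>M i\<in>?I. (borel :: real measure)"
  let ?F = "\<lambda>\<omega>. \<lambda>j\<in>?I. X j \<omega>"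
  have F[measurable]: "?F \<in> measurable M ?P"
    by (intro measurable_restrict rv)
  define N where "N = distr M ?P ?F"
  have N_eq: "N = (\<Pi>\<^sub>M i\<in>?I. distr M borel (X i))"
    unfolding N_def using indep rv by (subst (asm) indep_vars_iff_distr_eq_PiM'[OF I]) auto
  interpret N: prob_space N
    unfolding N_def by (rule prob_space_distr[OF F])
  have comp[measurable]: "(\<lambda>x. x j) \<in> borel_measurable N" if "j \<in> ?I" for j
    unfolding N_def using that by (simp add: measurable_component_singleton)
  have comp': "(\<lambda>x. x j) \<in> borel_measurable ?P" if "j \<in> ?I" for j
    using that by (simp add: measurable_component_singleton)
  have marginal: "distr N borel (\<lambda>x. x j) = distr M borel (X j)" if "j \<in> ?I" for j
    unfolding N_def using that
    by (subst distr_distr[OF comp' F]) (auto simp: comp_def intro!: distr_cong)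
  \<comment> \<open>Functions in the space of \<open>N\<close> are extensional, so restriction is
    the identity there. Thus the joint law of the coordinates is \<open>N\<close> itself, the
    product of its marginals, which is the criterion for independence.\<close>
  have "distr N ?P (\<lambda>x. \<lambda>j\<in>?I. x j) = distr N N (\<lambda>x. x)"
  proof (rule distr_cong)
    show "sets ?P = sets N"
      by (simp add: N_def)
    show "restrict x ?I = x" if "x \<in> space N" for x
      using that by (auto simp: N_def space_PiM PiE_def intro: extensional_restrict)
  qed simp
  also have "\<dots> = N"
    by (rule distr_id)
  also have "\<dots> = (\<Pi>\<^sub>M i\<in>?I. distr N borel (\<lambda>x. x i))"
    unfolding N_eq[symmetric] by (subst N_eq, rule PiM_cong) (simp_all add: marginal)
  finally have indep_N: "N.indep_vars (\<lambda>_. borel) (\<lambda>j x. x j) ?I"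
    by (subst N.indep_vars_iff_distr_eq_PiM'[OF I]) auto
  have int_N: "integrable N (\<lambda>x. f (x j)) \<longleftrightarrow> integrable M (\<lambda>\<omega>. f (X j \<omega>))"
    "(\<integral>x. f (x j) \<partial>N) = (\<integral>\<omega>. f (X j \<omega>) \<partial>M)"
    if "j \<in> ?I" "f \<in> borel_measurable borel" for j and f :: "real \<Rightarrow> real"
  proof -
    note meas = measurable_compose[OF comp'[OF that(1)] that(2)]
    show "integrable N (\<lambda>x. f (x j)) \<longleftrightarrow> integrable M (\<lambda>\<omega>. f (X j \<omega>))"
      "(\<integral>x. f (x j) \<partial>N) = (\<integral>\<omega>. f (X j \<omega>) \<partial>M)"
      unfolding N_def using that(1) integrable_distr_eq[OF F meas] integral_distr[OF F meas] by simp_all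
  qed
  have "iid_standardized N n (\<lambda>j x. x j) \<delta>"
    unfolding iid_standardized_def
  proof (intro conjI ballI)
    have one: "1 \<in> ?I"
      using n by simp
    show "integrable N (\<lambda>x. \<bar>x 1\<bar> ^ 4)" "(\<integral>x. \<bar>x 1\<bar> ^ 4 \<partial>N) \<le> \<delta> ^ 4"
      using int_N[OF one, of "\<lambda>x. \<bar>x\<bar> ^ 4"] iid_standardizedD(7,8)[OF iid] by simp_all
    fix j assume j: "j \<in> ?I"
    show "distr N borel (\<lambda>x. x j) = distr N borel (\<lambda>x. x 1)"
      unfolding marginal[OF j] marginal[OF one] by (rule iid_standardizedD(3)[OF iid j])
    show "integrable N (\<lambda>x. x j)"
      using int_N(1)[OF j, of "\<lambda>x. x"] iid_standardizedD(4)[OF iid j] by simp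
    show mean: "(\<integral>x. x j \<partial>N) = 0"
      using int_N(2)[OF j, of "\<lambda>x. x"] iid_standardizedD(5)[OF iid j] by simp
    show "(\<integral>x. (x j - (\<integral>x. x j \<partial>N))\<^sup>2 \<partial>N) = 1"
      unfolding mean using int_N(2)[OF j, of "\<lambda>x. x\<^sup>2"] iid_standardizedD(6)[OF iid j] by simp
  qed (fact N.prob_space_axioms indep_N)+
  then have "normal_discrepancy N (\<lambda>x. \<Sum>j=1..n. theta n j * x j) \<le> C * \<delta> ^ 4 / n"
    using assms n \<delta> unfolding berry_esseen_on_def by blast
  moreover have "\<P>(x in N. \<alpha> \<le> (\<Sum>j=1..n. theta n j * x j) \<and> (\<Sum>j=1..n. theta n j * x j) \<le> \<beta>)
      = \<P>(\<omega> in M. \<alpha> \<le> (\<Sum>j=1..n. theta n j * X j \<omega>) \<and> (\<Sum>j=1..n. theta n j * X j \<omega>) \<le> \<beta>)" for \<alpha> \<beta>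
  proof -
    have [measurable]: "(\<lambda>x. \<Sum>j=1..n. theta n j * x j) \<in> borel_measurable ?P"
      using comp' by (auto intro!: borel_measurable_sum borel_measurable_times)
    have "{x \<in> space ?P. \<alpha> \<le> (\<Sum>j=1..n. theta n j * x j) \<and> (\<Sum>j=1..n. theta n j * x j) \<le> \<beta>} \<in> sets ?P"
      by measurable
    then show ?thesis
      unfolding N_def using measurable_space[OF F]
      by (subst measure_distr[OF F]) (auto intro!: arg_cong[where f = "measure M"])
  qed
  ultimately show "normal_discrepancy M (\<lambda>\<omega>. \<Sum>j=1..n. theta n j * X j \<omega>) \<le> C * \<delta> ^ 4 / n"
    by (simp add: normal_discrepancy_def)
qed

theorem mainTheorem3:
  "(\<exists>C>0. \<forall>M :: (nat \<Rightarrow> real) measure. berry_esseen_on M C) \<and>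
   (\<forall>C>0. (\<forall>M :: (nat \<Rightarrow> real) measure. berry_esseen_on M C) \<longrightarrow>
           (\<forall>M :: 'a measure. berry_esseen_on M C))"
proof (intro conjI)
  obtain C where C: "0 < C" "\<And>\<mu> T \<epsilon> x. \<lbrakk>real_distribution \<mu>; integrable \<mu> (\<lambda>x. x); 0 < T; 0 \<le> \<epsilon>;
      (\<integral>\<^sup>+t\<in>{0<..T}. ennreal (cmod (char \<mu> t - char std_normal_distribution t) / t) \<partial>lborel) \<le> ennreal \<epsilon>\<rbrakk>
      \<Longrightarrow> \<bar>cdf \<mu> x - cdf std_normal_distribution x\<bar> \<le> C * (\<epsilon> + 1 / T)"
    by (rule Esseen_smoothing) blast
  show "\<exists>C>0. \<forall>M :: (nat \<Rightarrow> real) measure. berry_esseen_on M C"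
    using C by (intro exI[of _ "8 * C * (10 ^ 12 + 1)"] conjI allI berry_esseen_theta) auto
qed (use berry_esseen_on_transfer in blast)

end
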